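(* Let $X$ be a semigroup acting semiuniformly on a uniform space $Y$. 1. $\|\mu\star\nu\|\le\|\mu\|\cdot\|\nu\|$ for all $\mu\in\mathbf{M}(X)$, $\nu\in\mathbf{M}(Y)$. 2. Let $B\subseteq\mathbf{M}(Y)$ be a set bounded in the norm $\|\cdot\|$, $\mu_0\in\mathbf{M_u}(X)$ and $\nu_0\in B$. When $\mathbf{M}(X)$, $B$ and $\mathbf{M}(Y)$ are endowed with their UEB topologies, the mapping $(\mu,\nu)\mapsto\mu\star\nu$ from $\mathbf{M}(X)\times B$ to $\mathbf{M}(Y)$ is jointly continuous at $(\mu_0,\nu_0)$. 3. The mapping $(\mu,\nu)\mapsto\mu\star\nu$ is jointly sequentially continuous from $\mathbf{M_u}(X)\times\mathbf{M_u}(Y)$ to $\mathbf{M_u}(Y)$ when $\mathbf{M_u}(X)$ and $\mathbf{M_u}(Y)$ are endowed with their weak* topologies. 4. Let $\mu_0\in\mathbf{M_u^+}(X)$ and $\nu_0\in\mathbf{M}^+(Y)$. When $\mathbf{M}^+(X)$ and $\mathbf{M}^+(Y)$ are endowed with their weak* topologies, the mapping $(\mu,\nu)\mapsto\mu\star\nu$ from $\mathbf{M}^+(X)\times\mathbf{M}^+(Y)$ to $\mathbf{M}^+(Y)$ is jointly continuous at $(\mu_0,\nu_0)$. 5. If $\mu\in\mathbf{M_u}(X)$ then the mapping $\nu\mapsto\mu\star\nu$ from $\mathbf{M}(Y)$ to itself is weak* continuous.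
   Context: All uniform spaces are Hausdorff, all linear spaces are over $\mathbb{R}$. A semigroup $X$ endowed with a uniformity acts semiuniformly on a uniform space $Y$ if there is given a map $m:X\times Y\to Y$ with $m(s,m(s',y))=m(ss',y)$ for all $s,s'\in X$, $y\in Y$, that is uniformly continuous from Isbell's semiuniform product $X * Y$ to $Y$, i.e. such that the set of maps $\{x\mapsto m(x,y): y\in Y\}$ from $X$ to $Y$ is uniformly equicontinuous and for each $x\in X$ the map $y\mapsto m(x,y)$ is uniformly continuous. For a uniform space $Z$: $\mathbf{U_b}(Z)$ is the space of bounded uniformly continuous real-valued functions on $Z$ with the sup norm; $\mathbf{M}(Z)$ is its norm dual, with dual norm $\|\cdot\|$; the weak* topology on $\mathbf{M}(Z)$ is the weak topology of the duality $\langle\mathbf{M}(Z),\mathbf{U_b}(Z)\rangle$. For a uniformly continuous pseudometric $\Delta$ on $Z$, $\mathrm{Lip}(\Delta)$ is the set of $f:Z\to[-1,1]$ with $|f(z)-f(z')|\le\Delta(z,z')$ for all $z,z'$, with the topology of pointwise convergence on $Z$. The UEB topology on $\mathbf{M}(Z)$ is the topology of uniform convergence on the sets $\mathrm{Lip}(\Delta)$, where $\Delta$ ranges over all uniformly continuous pseudometrics on $Z$ (equivalently, uniform convergence on bounded uniformly equicontinuous subsets of $\mathbf{U_b}(Z)$). $\mathbf{M_u}(Z)$ is the set of $\mu\in\mathbf{M}(Z)$ that are continuous on $\mathrm{Lip}(\Delta)$ for every uniformly continuous pseudometric $\Delta$ on $Z$. $\mathbf{M}^+(Z)$ is the set of $\mu\in\mathbf{M}(Z)$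 with $\mu(f)\ge0$ for all $f\in\mathbf{U_b}(Z)$ with $f\ge0$, and $\mathbf{M_u^+}(Z)=\mathbf{M_u}(Z)\cap\mathbf{M}^+(Z)$. Subsets of $\mathbf{M}(Z)$ carry the subspace topologies. Convolution: for $\mu\in\mathbf{M}(X)$, $\nu\in\mathbf{M}(Y)$ the element $\mu\star\nu\in\mathbf{M}(Y)$ is defined by $(\mu\star\nu)(f)=\mu\big(x\mapsto \nu(y\mapsto f(m(x,y)))\big)$ for $f\in\mathbf{U_b}(Y)$ (the inner function of $x$ is in $\mathbf{U_b}(X)$). It maps $\mathbf{M_u}(X)\times\mathbf{M_u}(Y)$ into $\mathbf{M_u}(Y)$ and $\mathbf{M}^+(X)\times\mathbf{M}^+(Y)$ into $\mathbf{M}^+(Y)$. *)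

theory Defs
  imports "HOL-Analysis.Analysis"
begin

section \<open>Bounded uniformly continuous functions\<close>

definition ucb_funs :: "('a::uniform_space \<Rightarrow> real) set" where
  "ucb_funs = {f. uniformly_continuous_on UNIV f \<and> bounded (range f)}"

lemma uniformly_continuous_real_iff:
  fixes f :: "'a::uniform_space \<Rightarrow> real"
  shows "uniformly_continuous_on UNIV f \<longleftrightarrow>
    (\<forall>e>0. eventually (\<lambda>(x, y). \<bar>f x - f y\<bar> < e) uniformity)"
  unfolding uniformly_continuous_on_uniformity uniformity_dist filterlim_INF filterlim_principal
  by (auto simp: case_prod_beta' dist_real_def)

lemma ucb_fun_const: "(\<lambda>_. c) \<in> ucb_funs"
  by (auto simp: ucb_funs_def uniformly_continuous_on_const image_constant_conv)

lemma ucb_fun_add: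
  assumes "f \<in> ucb_funs" "g \<in> ucb_funs"
  shows "(\<lambda>x. f x + g x) \<in> ucb_funs"
proof -
  have "eventually (\<lambda>(x, y). \<bar>(f x + g x) - (f y + g y)\<bar> < e) uniformity" if "e > 0" for e
  proof -
    have "eventually (\<lambda>(x, y). \<bar>f x - f y\<bar> < e / 2) uniformity"
         "eventually (\<lambda>(x, y). \<bar>g x - g y\<bar> < e / 2) uniformity"
      using assms that half_gt_zero[OF that]
      unfolding ucb_funs_def uniformly_continuous_real_iff by blast+
    then show ?thesis
    proof eventually_elim
      case (elim p)
      then show ?case
        unfolding case_prod_beta by linarith
    qed
  qed
  then show ?thesis
    using assms by (auto simp: ucb_funs_def uniformly_continuous_real_iff intro!: bounded_plus_comp)
qed

lemma ucb_fun_scale: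
  assumes "f \<in> ucb_funs"
  shows "(\<lambda>x. c * f x) \<in> ucb_funs"
proof (cases "c = 0")
  case True
  then show ?thesis using ucb_fun_const[of 0] by simp
next
  case False
  have "eventually (\<lambda>(x, y). \<bar>c * f x - c * f y\<bar> < e) uniformity" if "e > 0" for e
  proof -
    have "e / \<bar>c\<bar> > 0" using that False by simp
    then have "eventually (\<lambda>(x, y). \<bar>f x - f y\<bar> < e / \<bar>c\<bar>) uniformity"
      using assms unfolding ucb_funs_def uniformly_continuous_real_iff by blast
    then show ?thesis
    proof eventually_elim
      case (elim p)
      obtain x y where p: "p = (x, y)" by force
      have "\<bar>c * f x - c * f y\<bar> = \<bar>c\<bar> * \<bar>f x - f y\<bar>"
        unfolding abs_mult[symmetric] by (simp only: right_diff_distrib)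
      also have "\<dots> < e"
        using elim False by (simp add: p pos_less_divide_eq mult.commute)
      finally show ?case by (simp add: p)
    qed
  qed
  moreover have "bounded (range (\<lambda>x. c * f x))"
    using assms bounded_scaleR_comp[of f UNIV c] by (simp add: ucb_funs_def)
  ultimately show ?thesis
    by (simp add: ucb_funs_def uniformly_continuous_real_iff)
qed

lemma ucb_fun_minus: "f \<in> ucb_funs \<Longrightarrow> (\<lambda>x. - f x) \<in> ucb_funs"
  using ucb_fun_scale[of f "- 1"] by simp

lemma ucb_fun_diff: "f \<in> ucb_funs \<Longrightarrow> g \<in> ucb_funs \<Longrightarrow> (\<lambda>x. f x - g x) \<in> ucb_funs"
  using ucb_fun_add[of f "\<lambda>x. - g x"] ucb_fun_minus[of g] by simp

typedef (overloaded) 'a ucb = "ucb_funs :: ('a::uniform_space \<Rightarrow> real) set"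
  morphisms apply_ucb Ucb
  using ucb_fun_const by blast

setup_lifting type_definition_ucb

lemma ucb_eqI: "(\<And>x. apply_ucb f x = apply_ucb g x) \<Longrightarrow> f = g"
  by transfer auto

lemma bdd_above_apply_ucb: "bdd_above (range (\<lambda>x. \<bar>apply_ucb f x\<bar>))"
proof -
  have "bounded (range (apply_ucb f))"
    using apply_ucb[of f] by (simp add: ucb_funs_def)
  then obtain B where "\<forall>x. \<bar>apply_ucb f x\<bar> \<le> B"
    by (auto simp: bounded_iff)
  then show ?thesis
    by (intro bdd_aboveI2) auto
qed

instantiation ucb :: (uniform_space) real_normed_vector
begin

lift_definition zero_ucb :: "'a ucb" is "\<lambda>_. 0"
  by (rule ucb_fun_const)

lift_definition plus_ucb :: "'a ucb \<Rightarrow> 'a ucb \<Rightarrow> 'a ucb" is "\<lambda>f g x. f x + g x"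
  by (rule ucb_fun_add)

lift_definition minus_ucb :: "'a ucb \<Rightarrow> 'a ucb \<Rightarrow> 'a ucb" is "\<lambda>f g x. f x - g x"
  by (rule ucb_fun_diff)

lift_definition uminus_ucb :: "'a ucb \<Rightarrow> 'a ucb" is "\<lambda>f x. - f x"
  by (rule ucb_fun_minus)

lift_definition scaleR_ucb :: "real \<Rightarrow> 'a ucb \<Rightarrow> 'a ucb" is "\<lambda>c f x. c * f x"
  by (rule ucb_fun_scale)

definition norm_ucb :: "'a ucb \<Rightarrow> real" where
  "norm_ucb f = (SUP x. \<bar>apply_ucb f x\<bar>)"

definition dist_ucb :: "'a ucb \<Rightarrow> 'a ucb \<Rightarrow> real" where
  "dist_ucb f g = norm (f - g)"

definition sgn_ucb :: "'a ucb \<Rightarrow> 'a ucb" where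
  "sgn_ucb f = scaleR (inverse (norm f)) f"

definition uniformity_ucb :: "('a ucb \<times> 'a ucb) filter" where
  "uniformity_ucb = (INF e\<in>{0<..}. principal {(f, g). dist f g < e})"

definition open_ucb :: "'a ucb set \<Rightarrow> bool" where
  "open_ucb S = (\<forall>f\<in>S. \<forall>\<^sub>F (f', g) in uniformity. f' = f \<longrightarrow> g \<in> S)"

lemmas ucb_rep_eqs [simp] =
  zero_ucb.rep_eq plus_ucb.rep_eq minus_ucb.rep_eq uminus_ucb.rep_eq scaleR_ucb.rep_eq

lemma abs_apply_ucb_le_norm: "\<bar>apply_ucb f x\<bar> \<le> norm f"
  unfolding norm_ucb_def by (rule cSUP_upper[OF UNIV_I bdd_above_apply_ucb])

lemma norm_ucb_le: "(\<And>x. \<bar>apply_ucb f x\<bar> \<le> b) \<Longrightarrow> norm f \<le> b"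
  unfolding norm_ucb_def by (rule cSUP_least) auto

instance
proof
  fix f g :: "'a ucb" and a b :: real
  show "(norm f = 0) = (f = 0)"
  proof
    assume "norm f = 0"
    then have "apply_ucb f x = 0" for x
      using abs_apply_ucb_le_norm[of f x] by simp
    then show "f = 0"
      by (intro ucb_eqI) simp
  qed (simp add: norm_ucb_def)
  show "norm (f + g) \<le> norm f + norm g"
  proof (rule norm_ucb_le)
    fix x
    show "\<bar>apply_ucb (f + g) x\<bar> \<le> norm f + norm g"
      using abs_apply_ucb_le_norm[of f x] abs_apply_ucb_le_norm[of g x] by simp
  qed
  have le: "norm (c *\<^sub>R h) \<le> \<bar>c\<bar> * norm h" for c and h :: "'a ucb"
    by (rule norm_ucb_le) (simp add: abs_mult mult_left_mono abs_apply_ucb_le_norm)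
  show "norm (a *\<^sub>R f) = \<bar>a\<bar> * norm f"
  proof (rule antisym[OF le])
    show "\<bar>a\<bar> * norm f \<le> norm (a *\<^sub>R f)"
    proof (cases "a = 0")
      case True
      then show ?thesis by (simp add: norm_ucb_def)
    next
      case False
      have "inverse a *\<^sub>R a *\<^sub>R f = f"
        using False by (intro ucb_eqI) simp
      then have "norm f \<le> \<bar>inverse a\<bar> * norm (a *\<^sub>R f)"
        using le[of "inverse a" "a *\<^sub>R f"] by simp
      then show ?thesis
        using False by (simp add: field_simps)
    qed
  qed
qed (auto intro!: ucb_eqI simp: algebra_simps dist_ucb_def sgn_ucb_def uniformity_ucb_def
      open_ucb_def)

end


section \<open>The dual space and its topologies\<close>

type_synonym 'a dual = "'a ucb \<Rightarrow>\<^sub>L real"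

definition weak_star :: "'a::uniform_space dual topology" where
  "weak_star = pullback_topology UNIV blinfun_apply euclidean"

definition uc_pseudometric :: "('a::uniform_space \<Rightarrow> 'a \<Rightarrow> real) \<Rightarrow> bool" where
  "uc_pseudometric \<Delta> \<longleftrightarrow>
    (\<forall>x y. 0 \<le> \<Delta> x y) \<and> (\<forall>x. \<Delta> x x = 0) \<and> (\<forall>x y. \<Delta> x y = \<Delta> y x) \<and>
    (\<forall>x y z. \<Delta> x z \<le> \<Delta> x y + \<Delta> y z) \<and>
    uniformly_continuous_on UNIV (\<lambda>(x, y). \<Delta> x y)"

definition Lip :: "('a \<Rightarrow> 'a \<Rightarrow> real) \<Rightarrow> ('a \<Rightarrow> real) set" where
  "Lip \<Delta> = {f. range f \<subseteq> {-1..1} \<and> (\<forall>x y. \<bar>f x - f y\<bar> \<le> \<Delta> x y)}"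

text \<open>By the next lemma, the abstraction \<^const>\<open>Ucb\<close> is meaningful on all of \<open>Lip \<Delta>\<close>.\<close>

lemma Lip_subset_ucb_funs:
  assumes "uc_pseudometric \<Delta>"
  shows "Lip \<Delta> \<subseteq> ucb_funs"
proof
  fix f assume f: "f \<in> Lip \<Delta>"
  have "eventually (\<lambda>(x, y). \<bar>f x - f y\<bar> < e) uniformity" if "e > 0" for e
  proof -
    have "eventually (\<lambda>(p, q). \<bar>case_prod \<Delta> p - case_prod \<Delta> q\<bar> < e) uniformity"
      using assms that unfolding uc_pseudometric_def uniformly_continuous_real_iff by blast
    then have "eventually (\<lambda>((x, x'), (y, y')). \<bar>\<Delta> x y - \<Delta> x' y'\<bar> < e)
        (uniformity \<times>\<^sub>F uniformity)"
      by (simp add: uniformity_prod_def eventually_filtermap case_prod_unfold)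
    then obtain P where P: "eventually P uniformity"
      and P': "\<And>x x' y y'. P (x, x') \<Longrightarrow> P (y, y') \<Longrightarrow> \<bar>\<Delta> x y - \<Delta> x' y'\<bar> < e"
      by (auto simp: eventually_prod_same)
    from P show ?thesis
    proof eventually_elim
      case (elim p)
      obtain x y where p: "p = (x, y)" by force
      have "P (x, x)" using P by (rule uniformity_refl)
      then have "\<bar>\<Delta> x x - \<Delta> x y\<bar> < e"
        using P'[of x x x y] elim p by simp
      moreover have "\<Delta> x x = 0" "\<bar>f x - f y\<bar> \<le> \<Delta> x y"
        using assms f by (auto simp: uc_pseudometric_def Lip_def)
      ultimately show ?case by (simp add: p)
    qed
  qed
  moreover have "bounded (range f)"
    using f by (auto simp: Lip_def intro: bounded_subset[OF bounded_closed_interval])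
  ultimately show "f \<in> ucb_funs"
    by (simp add: ucb_funs_def uniformly_continuous_real_iff)
qed

definition ueb_seminorm :: "('a::uniform_space \<Rightarrow> 'a \<Rightarrow> real) \<Rightarrow> 'a dual \<Rightarrow> real" where
  "ueb_seminorm \<Delta> \<mu> = (SUP f\<in>Lip \<Delta>. \<bar>blinfun_apply \<mu> (Ucb f)\<bar>)"

definition ueb :: "'a::uniform_space dual topology" where
  "ueb = topology_generated_by
    {{\<nu>. ueb_seminorm \<Delta> (\<nu> - \<mu>) < e} | \<Delta> \<mu> e. uc_pseudometric \<Delta> \<and> 0 < e}"

text \<open>The topology on \<open>Lip \<Delta>\<close> is that of the product topology on the type \<open>'a \<Rightarrow> real\<close>, that is,
  pointwise convergence.\<close>

definition Mu :: "'a::uniform_space dual set" where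
  "Mu = {\<mu>. \<forall>\<Delta>. uc_pseudometric \<Delta> \<longrightarrow> continuous_on (Lip \<Delta>) (\<lambda>f. blinfun_apply \<mu> (Ucb f))}"

definition Mpos :: "'a::uniform_space dual set" where
  "Mpos = {\<mu>. \<forall>f. (\<forall>x. 0 \<le> apply_ucb f x) \<longrightarrow> 0 \<le> blinfun_apply \<mu> f}"

definition Mupos :: "'a::uniform_space dual set" where
  "Mupos = Mu \<inter> Mpos"


section \<open>Semiuniform actions and convolution\<close>

text \<open>No relation between the multiplication and the uniformity of \<open>'x\<close> is required. The last two
  conjuncts say that \<open>m\<close> is uniformly continuous on the semiuniform product.\<close>

definition semiuniform_action ::
  "('x::{uniform_space, semigroup_mult} \<Rightarrow> 'y::uniform_space \<Rightarrow> 'y) \<Rightarrow> bool" where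
  "semiuniform_action m \<longleftrightarrow>
    (\<forall>s s' y. m s (m s' y) = m (s * s') y) \<and>
    (\<forall>E. eventually E uniformity \<longrightarrow>
      eventually (\<lambda>(x, x'). \<forall>y. E (m x y, m x' y)) uniformity) \<and>
    (\<forall>x. uniformly_continuous_on UNIV (m x))"

definition conv :: "('x::uniform_space \<Rightarrow> 'y::uniform_space \<Rightarrow> 'y) \<Rightarrow> 'x dual \<Rightarrow> 'y dual \<Rightarrow> 'y dual"
  where "conv m \<mu> \<nu> = Blinfun (\<lambda>f. blinfun_apply \<mu>
    (Ucb (\<lambda>x. blinfun_apply \<nu> (Ucb (\<lambda>y. apply_ucb f (m x y))))))"

text \<open>The following lemmas show that for a semiuniform action the abstractions \<^const>\<open>Ucb\<close> and
  \<^const>\<open>Blinfun\<close> in the definition of \<^const>\<open>conv\<close> are applied to members of the respective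
  types.\<close>

lemma semiuniform_action_inner:
  assumes "semiuniform_action m"
  shows "(\<lambda>y. apply_ucb f (m x y)) \<in> ucb_funs"
proof -
  have uc: "uniformly_continuous_on UNIV (apply_ucb f)" and b: "bounded (range (apply_ucb f))"
    using apply_ucb[of f] by (auto simp: ucb_funs_def)
  have "uniformly_continuous_on (range (m x)) (apply_ucb f)"
    unfolding uniformly_continuous_on_uniformity
    by (rule filterlim_mono[OF uc[unfolded uniformly_continuous_on_uniformity]]) simp_all
  then have "uniformly_continuous_on UNIV (\<lambda>y. apply_ucb f (m x y))"
    by (rule uniformly_continuous_on_compose[rotated])
      (use assms in \<open>unfold semiuniform_action_def, blast\<close>)
  moreover have "bounded (range (\<lambda>y. apply_ucb f (m x y)))"
    using b by (rule bounded_subset) auto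
  ultimately show ?thesis by (simp add: ucb_funs_def)
qed

lemma abs_blinfun_ucb_le:
  assumes "g \<in> ucb_funs" "\<And>y. \<bar>g y\<bar> \<le> b"
  shows "\<bar>blinfun_apply \<nu> (Ucb g)\<bar> \<le> norm \<nu> * b"
proof -
  have "norm (Ucb g) \<le> b"
    using assms by (intro norm_ucb_le) (simp add: Ucb_inverse)
  then have "norm \<nu> * norm (Ucb g) \<le> norm \<nu> * b"
    by (rule mult_left_mono) simp
  then show ?thesis
    using norm_blinfun[of \<nu> "Ucb g"] by simp
qed

lemma semiuniform_action_outer:
  assumes "semiuniform_action m"
  shows "(\<lambda>x. blinfun_apply \<nu> (Ucb (\<lambda>y. apply_ucb f (m x y)))) \<in> ucb_funs" (is "?F \<in> _")
proof -
  note inner = semiuniform_action_inner[OF assms, of f]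
  have "eventually (\<lambda>(x, x'). \<bar>?F x - ?F x'\<bar> < e) uniformity" if "e > 0" for e
  proof -
    define d where "d = e / (norm \<nu> + 1)"
    have d: "d > 0" using that by (simp add: d_def add_nonneg_pos)
    have "norm \<nu> + 1 > 0" by (simp add: add_nonneg_pos)
    then have nd: "norm \<nu> * d < e"
      using that by (simp add: d_def field_simps)
    have "eventually (\<lambda>(y, y'). \<bar>apply_ucb f y - apply_ucb f y'\<bar> < d) uniformity"
      using apply_ucb[of f] d by (auto simp: ucb_funs_def uniformly_continuous_real_iff)
    then have "eventually (\<lambda>(x, x'). \<forall>y. \<bar>apply_ucb f (m x y) - apply_ucb f (m x' y)\<bar> < d) uniformity"
      using conjunct1[OF conjunct2[OF assms[unfolded semiuniform_action_def]], rule_format,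
        of "\<lambda>(y, y'). \<bar>apply_ucb f y - apply_ucb f y'\<bar> < d"] by simp
    then show ?thesis
    proof eventually_elim
      case (elim p)
      obtain x x' where p: "p = (x, x')" by force
      let ?g = "\<lambda>y. apply_ucb f (m x y) - apply_ucb f (m x' y)"
      have "Ucb ?g = Ucb (\<lambda>y. apply_ucb f (m x y)) - Ucb (\<lambda>y. apply_ucb f (m x' y))"
        by (rule ucb_eqI)
          (simp only: Ucb_inverse[OF inner] Ucb_inverse[OF ucb_fun_diff[OF inner inner]]
            minus_ucb.rep_eq)
      then have "?F x - ?F x' = blinfun_apply \<nu> (Ucb ?g)"
        by (simp add: blinfun.diff_right)
      also have "\<bar>\<dots>\<bar> \<le> norm \<nu> * d"
      proof (rule abs_blinfun_ucb_le[OF ucb_fun_diff[OF inner inner]])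
        show "\<bar>apply_ucb f (m x y) - apply_ucb f (m x' y)\<bar> \<le> d" for y
          using elim p by (simp add: less_imp_le)
      qed
      finally show ?case using nd p by simp
    qed
  qed
  moreover have "bounded (range ?F)"
  proof (rule boundedI)
    fix r assume "r \<in> range ?F"
    then obtain x where r: "r = ?F x" by blast
    show "norm r \<le> norm \<nu> * norm f"
      unfolding r real_norm_def by (rule abs_blinfun_ucb_le[OF inner abs_apply_ucb_le_norm])
  qed
  ultimately show ?thesis
    by (simp add: ucb_funs_def uniformly_continuous_real_iff)
qed

lemma blinfun_apply_conv:
  assumes "semiuniform_action m"
  shows "blinfun_apply (conv m \<mu> \<nu>) f =
    blinfun_apply \<mu> (Ucb (\<lambda>x. blinfun_apply \<nu> (Ucb (\<lambda>y. apply_ucb f (m x y)))))"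
proof -
  note inner = semiuniform_action_inner[OF assms]
  note outer = semiuniform_action_outer[OF assms]
  define F where "F f x = blinfun_apply \<nu> (Ucb (\<lambda>y. apply_ucb f (m x y)))" for f x
  have F_ucb: "F f \<in> ucb_funs" for f
    unfolding F_def by (rule outer)
  have "bounded_linear (\<lambda>f. blinfun_apply \<mu> (Ucb (F f)))"
  proof (rule bounded_linear_intro)
    fix f g
    have "Ucb (\<lambda>y. apply_ucb (f + g) (m x y)) =
        Ucb (\<lambda>y. apply_ucb f (m x y)) + Ucb (\<lambda>y. apply_ucb g (m x y))" for x
      by (rule ucb_eqI)
        (simp only: Ucb_inverse[OF inner] Ucb_inverse[OF ucb_fun_add[OF inner inner]]
          plus_ucb.rep_eq)
    then have F_hom: "F (f + g) x = F f x + F g x" for x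
      by (simp only: F_def blinfun.add_right)
    have "Ucb (F (f + g)) = Ucb (F f) + Ucb (F g)"
      by (rule ucb_eqI)
        (simp only: Ucb_inverse[OF F_ucb] Ucb_inverse[OF ucb_fun_add[OF F_ucb F_ucb]]
          plus_ucb.rep_eq F_hom)
    then show "blinfun_apply \<mu> (Ucb (F (f + g))) =
        blinfun_apply \<mu> (Ucb (F f)) + blinfun_apply \<mu> (Ucb (F g))"
      by (simp only: blinfun.add_right)
  next
    fix c f
    have "Ucb (\<lambda>y. apply_ucb (c *\<^sub>R f) (m x y)) = c *\<^sub>R Ucb (\<lambda>y. apply_ucb f (m x y))" for x
      by (rule ucb_eqI)
        (simp only: Ucb_inverse[OF inner] Ucb_inverse[OF ucb_fun_scale[OF inner]]
          scaleR_ucb.rep_eq)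
    then have F_hom: "F (c *\<^sub>R f) x = c * F f x" for x
      by (simp only: F_def blinfun.scaleR_right real_scaleR_def)
    have "Ucb (F (c *\<^sub>R f)) = c *\<^sub>R Ucb (F f)"
      by (rule ucb_eqI)
        (simp only: Ucb_inverse[OF F_ucb] Ucb_inverse[OF ucb_fun_scale[OF F_ucb]]
          scaleR_ucb.rep_eq F_hom)
    then show "blinfun_apply \<mu> (Ucb (F (c *\<^sub>R f))) = c *\<^sub>R blinfun_apply \<mu> (Ucb (F f))"
      by (simp only: blinfun.scaleR_right)
  next
    fix f
    have "\<bar>F f x\<bar> \<le> norm \<nu> * norm f" for x
      unfolding F_def by (rule abs_blinfun_ucb_le[OF inner abs_apply_ucb_le_norm])
    then have "\<bar>blinfun_apply \<mu> (Ucb (F f))\<bar> \<le> norm \<mu> * (norm \<nu> * norm f)"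
      by (rule abs_blinfun_ucb_le[OF F_ucb])
    then show "norm (blinfun_apply \<mu> (Ucb (F f))) \<le> norm f * (norm \<mu> * norm \<nu>)"
      by (simp add: ac_simps)
  qed
  then show ?thesis
    unfolding conv_def F_def by (simp only: bounded_linear_Blinfun_apply)
qed


section \<open>Sequential continuity\<close>

definition sequentially_continuous_map :: "'a topology \<Rightarrow> 'b topology \<Rightarrow> ('a \<Rightarrow> 'b) \<Rightarrow> bool" where
  "sequentially_continuous_map X Y f \<longleftrightarrow>
    f \<in> topspace X \<rightarrow> topspace Y \<and>
    (\<forall>\<sigma> l. range \<sigma> \<subseteq> topspace X \<and> limitin X \<sigma> l sequentially \<longrightarrow>
      limitin Y (\<lambda>n. f (\<sigma> n)) (f l) sequentially)"

end

theory Submission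
  imports Defs
begin

text \<open>Write \<open>F\<^sub>\<nu>(x) = \<nu>(y \<mapsto> f(m x y))\<close> for the function to which \<open>\<mu>\<close> is applied in \<open>\<mu> \<star> \<nu>\<close>
(\<open>fibre_integral\<close> below). If \<open>f \<in> Lip \<Delta>\<close>, then \<open>F\<^sub>\<nu>\<close> lies in \<open>\<parallel>\<nu>\<parallel> Lip \<Delta>'\<close>, where
\<open>\<Delta>'(x, x') = sup\<^sub>y min 2 (\<Delta>(m x y, m x' y))\<close>; the equicontinuity required of a
semiuniform action says precisely that \<open>\<Delta>'\<close> is uniformly continuous for every \<open>\<Delta>\<close>.
The norm estimate is immediate. For the joint continuity statements, decompose
\<open>(\<mu> \<star> \<nu>)(f) - (\<mu>\<^sub>0 \<star> \<nu>\<^sub>0)(f) = (\<mu> - \<mu>\<^sub>0)(F\<^sub>\<nu>) + \<mu>\<^sub>0(F\<^bsub>\<nu>-\<nu>\<^sub>0\<^esub>)\<close>.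
The first term is at most \<open>\<parallel>\<nu>\<parallel>\<close> times the supremum of \<open>\<mu> - \<mu>\<^sub>0\<close> over \<open>Lip \<Delta>'\<close>. In the second one,
\<open>\<mu>\<^sub>0 \<in> Mu\<close> is continuous on \<open>Lip \<Delta>'\<close> for pointwise convergence, so that it suffices that
\<open>F\<^bsub>\<nu>-\<nu>\<^sub>0\<^esub>\<close> is small at finitely many points \<open>x\<close>, that is, that \<open>\<nu> - \<nu>\<^sub>0\<close> is small on finitely many
functions \<open>f \<circ> m x\<close>. This is the lemma \<open>conv_close\<close>. Each of the three joint continuity statements
follows from it once \<open>\<mu> - \<mu>\<^sub>0\<close> is known to be small uniformly on \<open>Lip \<Delta>'\<close>:

 \<^item> for the UEB topology this is the definition of the topology;

 \<^item> for positive functionals, a point of \<open>Mupos\<close> has the same weak* and UEB neighbourhoods in \<open>Mpos\<close>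
   (\<open>Mupos_weak_star_uniform_on_Lip\<close>): \<open>\<mu>\<^sub>0\<close>, hence also any nearby positive \<open>\<mu>\<close>, gives little mass to
   the complement of a neighbourhood of a finite set \<open>K\<close>, and near \<open>K\<close> the members of \<open>Lip \<Delta>'\<close> are
   determined up to a small error by finitely many of them;

 \<^item> for sequences, a weak* null sequence in \<open>Mu\<close> converges to \<open>0\<close> uniformly on \<open>Lip \<Delta>'\<close>
   (\<open>Mu_weak_star_null_sequence_uniform_on_Lip\<close>), a generalization of the Schur property of \<open>\<ell>\<^sup>1\<close>,
   which is the case of a discrete space. It is derived from the Baire category theorem on a compact
   set \<open>Lip D\<close>. The norm bounds that it needs come from the uniform boundedness principle.

For the last statement, the functionals in \<open>Mu\<close> are limits, uniformly on each \<open>Lip \<Delta>'\<close>, of finite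
linear combinations of point evaluations (\<open>Mu_molecular_approximation\<close>). For such combinations the
order of \<open>\<mu>\<close> and \<open>\<nu>\<close> can be exchanged, hence in general \<open>(\<mu> \<star> \<nu>)(f) = \<nu>(h)\<close> for
\<open>h(y) = \<mu>(x \<mapsto> f(m x y))\<close>, and \<open>h\<close> is again bounded and uniformly continuous. So \<open>\<nu> \<mapsto> \<mu> \<star> \<nu>\<close> is
the adjoint of a map of function spaces.\<close>

section \<open>Functionals applied to plain functions\<close>

text \<open>Most functions occurring below arise as \<open>\<lambda>\<close>-terms rather than as elements of the type of bounded
uniformly continuous functions, so functionals are evaluated through the abstraction map.\<close>

abbreviation pair :: "'a::uniform_space dual \<Rightarrow> ('a \<Rightarrow> real) \<Rightarrow> real" where
  "pair \<mu> f \<equiv> blinfun_apply \<mu> (Ucb f)"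

lemma pair_add:
  assumes "f \<in> ucb_funs" "g \<in> ucb_funs"
  shows "pair \<mu> (\<lambda>x. f x + g x) = pair \<mu> f + pair \<mu> g"
proof -
  have "Ucb (\<lambda>x. f x + g x) = Ucb f + Ucb g"
    by (rule ucb_eqI) (simp add: Ucb_inverse assms ucb_fun_add)
  then show ?thesis by (simp add: blinfun.add_right)
qed

lemma pair_diff:
  assumes "f \<in> ucb_funs" "g \<in> ucb_funs"
  shows "pair \<mu> (\<lambda>x. f x - g x) = pair \<mu> f - pair \<mu> g"
proof -
  have "Ucb (\<lambda>x. f x - g x) = Ucb f - Ucb g"
    by (rule ucb_eqI) (simp add: Ucb_inverse assms ucb_fun_diff)
  then show ?thesis by (simp add: blinfun.diff_right)
qed

lemma pair_scale:
  assumes "f \<in> ucb_funs"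
  shows "pair \<mu> (\<lambda>x. c * f x) = c * pair \<mu> f"
proof -
  have "Ucb (\<lambda>x. c * f x) = c *\<^sub>R Ucb f"
    by (rule ucb_eqI) (simp add: Ucb_inverse assms ucb_fun_scale)
  then show ?thesis by (simp add: blinfun.scaleR_right)
qed

lemma ucb_fun_sum:
  assumes "\<And>i. i \<in> I \<Longrightarrow> f i \<in> ucb_funs"
  shows "(\<lambda>x. \<Sum>i\<in>I. f i x) \<in> ucb_funs"
  using assms by (induction I rule: infinite_finite_induct) (auto intro: ucb_fun_const ucb_fun_add)

lemma pair_sum:
  assumes "\<And>i. i \<in> I \<Longrightarrow> f i \<in> ucb_funs"
  shows "pair \<mu> (\<lambda>x. \<Sum>i\<in>I. f i x) = (\<Sum>i\<in>I. pair \<mu> (f i))"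
proof -
  have z: "pair \<mu> (\<lambda>x. 0) = 0"
    using pair_scale[OF ucb_fun_const, of \<mu> 0 0] by simp
  show ?thesis
    using assms
    by (induction I rule: infinite_finite_induct) (simp_all add: z pair_add ucb_fun_sum)
qed

lemma ucb_funs_bounded:
  assumes "f \<in> ucb_funs"
  obtains b where "0 < b" "\<And>x. \<bar>f x\<bar> \<le> b"
proof -
  obtain b where "\<forall>x. \<bar>f x\<bar> \<le> b"
    using assms by (auto simp: ucb_funs_def bounded_iff)
  then have "0 < \<bar>b\<bar> + 1" "\<And>x. \<bar>f x\<bar> \<le> \<bar>b\<bar> + 1"
    by (auto intro: order_trans)
  then show ?thesis by (rule that)
qed

section \<open>Uniformly continuous pseudometrics and Lipschitz functions\<close>

text \<open>By the triangle inequality a pseudometric is uniformly continuous on the product as soon as it is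
small on some entourage; this is the form in which uniform continuity is verified and used.\<close>

lemma uc_pseudometricI:
  assumes "\<And>x y. 0 \<le> \<Delta> x y" "\<And>x. \<Delta> x x = 0" "\<And>x y. \<Delta> x y = \<Delta> y x"
    and tri: "\<And>x y z. \<Delta> x z \<le> \<Delta> x y + \<Delta> y z"
    and small: "\<And>e. e > 0 \<Longrightarrow> eventually (\<lambda>(x, y). \<Delta> x y < e) uniformity"
  shows "uc_pseudometric \<Delta>"
proof -
  have "eventually (\<lambda>(p, q). \<bar>case_prod \<Delta> p - case_prod \<Delta> q\<bar> < e) uniformity" if "e > 0" for e
  proof -
    have ev: "eventually (\<lambda>(x, y). \<Delta> x y < e / 2) uniformity"
      using small[of "e / 2"] that by simp
    have "eventually (\<lambda>((x, x'), (y, y')). \<bar>\<Delta> x y - \<Delta> x' y'\<bar> < e)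
        (uniformity \<times>\<^sub>F uniformity)"
      unfolding eventually_prod_same
    proof (intro exI conjI allI impI)
      show "eventually (\<lambda>(x, y). \<Delta> x y < e / 2) uniformity" by (rule ev)
      fix p q assume "case p of (x, y) \<Rightarrow> \<Delta> x y < e / 2" "case q of (x, y) \<Rightarrow> \<Delta> x y < e / 2"
      moreover obtain x x' y y' where pq: "p = (x, x')" "q = (y, y')" by fastforce
      moreover have "\<Delta> x y \<le> \<Delta> x x' + (\<Delta> x' y' + \<Delta> y' y)" "\<Delta> x' y' \<le> \<Delta> x' x + (\<Delta> x y + \<Delta> y y')"
        using tri[of x y x'] tri[of x' y y'] tri[of x' y' x] tri[of x y' y] by auto
      moreover have "\<Delta> x' x = \<Delta> x x'" "\<Delta> y' y = \<Delta> y y'" using assms(3) by auto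
      ultimately show "case (p, q) of (x, xa) \<Rightarrow> (case x of (x, x') \<Rightarrow> \<lambda>(y, y'). \<bar>\<Delta> x y - \<Delta> x' y'\<bar> < e) xa"
        by (simp add: abs_less_iff)
    qed
    then show ?thesis
      by (simp add: uniformity_prod_def eventually_filtermap case_prod_unfold)
  qed
  then show ?thesis
    using assms unfolding uc_pseudometric_def uniformly_continuous_real_iff by blast
qed

lemma uc_pseudometricD:
  assumes "uc_pseudometric \<Delta>"
  shows "0 \<le> \<Delta> x y" "\<Delta> x x = 0" "\<Delta> x y = \<Delta> y x" "\<Delta> x z \<le> \<Delta> x y + \<Delta> y z"
  using assms by (auto simp: uc_pseudometric_def)

lemma uc_pseudometric_eventually_small:
  assumes "uc_pseudometric \<Delta>" "e > 0"
  shows "eventually (\<lambda>(x, y). \<Delta> x y < e) uniformity"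
proof -
  have "eventually (\<lambda>(p, q). \<bar>case_prod \<Delta> p - case_prod \<Delta> q\<bar> < e) uniformity"
    using assms unfolding uc_pseudometric_def uniformly_continuous_real_iff by blast
  then have "eventually (\<lambda>((x, x'), (y, y')). \<bar>\<Delta> x y - \<Delta> x' y'\<bar> < e)
      (uniformity \<times>\<^sub>F uniformity)"
    by (simp add: uniformity_prod_def eventually_filtermap case_prod_unfold)
  then obtain P where P: "eventually P uniformity"
    and P': "\<And>x x' y y'. P (x, x') \<Longrightarrow> P (y, y') \<Longrightarrow> \<bar>\<Delta> x y - \<Delta> x' y'\<bar> < e"
    by (auto simp: eventually_prod_same)
  from P show ?thesis
  proof eventually_elim
    case (elim p)
    obtain x y where p: "p = (x, y)" by force
    have "P (x, x)" using P by (rule uniformity_refl)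
    then have "\<bar>\<Delta> x x - \<Delta> x y\<bar> < e"
      using P'[of x x x y] elim p by simp
    then show ?case using uc_pseudometricD[OF assms(1)] by (simp add: p)
  qed
qed

lemma uc_pseudometric_add:
  assumes "uc_pseudometric \<Delta>" "uc_pseudometric \<Delta>'"
  shows "uc_pseudometric (\<lambda>x y. \<Delta> x y + \<Delta>' x y)"
proof (rule uc_pseudometricI)
  fix e :: real assume "e > 0"
  then have "e / 2 > 0" by simp
  then have "eventually (\<lambda>(x, y). \<Delta> x y < e / 2) uniformity"
    "eventually (\<lambda>(x, y). \<Delta>' x y < e / 2) uniformity"
    by (simp_all only: uc_pseudometric_eventually_small assms)
  then show "eventually (\<lambda>(x, y). \<Delta> x y + \<Delta>' x y < e) uniformity"
    by eventually_elim auto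
next
  show "\<Delta> x z + \<Delta>' x z \<le> \<Delta> x y + \<Delta>' x y + (\<Delta> y z + \<Delta>' y z)" for x y z
    using uc_pseudometricD(4)[OF assms(1), of x z y] uc_pseudometricD(4)[OF assms(2), of x z y] by linarith
qed (use uc_pseudometricD[OF assms(1)] uc_pseudometricD[OF assms(2)] in auto)

lemma uc_pseudometric_scale:
  assumes "uc_pseudometric \<Delta>" "c > 0"
  shows "uc_pseudometric (\<lambda>x y. c * \<Delta> x y)"
proof (rule uc_pseudometricI)
  fix e :: real assume "e > 0"
  then have "e / c > 0" using assms by simp
  with assms(1) have "eventually (\<lambda>(x, y). \<Delta> x y < e / c) uniformity"
    by (rule uc_pseudometric_eventually_small)
  then show "eventually (\<lambda>(x, y). c * \<Delta> x y < e) uniformity"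
    by eventually_elim (use assms in \<open>auto simp: field_simps\<close>)
next
  show "c * \<Delta> x z \<le> c * \<Delta> x y + c * \<Delta> y z" for x y z
    unfolding distrib_left[symmetric]
    using uc_pseudometricD(4)[OF assms(1), of x z y] assms(2) by (intro mult_left_mono) auto
qed (use assms uc_pseudometricD[OF assms(1)] in auto)

lemma uc_pseudometric_pullback:
  assumes "uc_pseudometric \<Delta>" "uniformly_continuous_on UNIV g"
  shows "uc_pseudometric (\<lambda>x y. \<Delta> (g x) (g y))"
proof (rule uc_pseudometricI)
  fix e :: real assume "e > 0"
  with assms(1) have "eventually (\<lambda>(x, y). \<Delta> x y < e) uniformity"
    by (rule uc_pseudometric_eventually_small)
  then have "eventually (\<lambda>p. case_prod (\<lambda>x y. \<Delta> x y < e) (case p of (x, y) \<Rightarrow> (g x, g y))) uniformity"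
    using assms(2) unfolding uniformly_continuous_on_uniformity filterlim_iff by auto
  then show "eventually (\<lambda>(x, y). \<Delta> (g x) (g y) < e) uniformity"
    by (simp add: case_prod_unfold)
qed (rule uc_pseudometricD[OF assms(1)])+

lemma LipI:
  assumes "\<And>x. \<bar>f x\<bar> \<le> 1" "\<And>x y. \<bar>f x - f y\<bar> \<le> \<Delta> x y"
  shows "f \<in> Lip \<Delta>"
  using assms by (auto simp: Lip_def abs_le_iff minus_le_iff)

lemma LipD:
  assumes "f \<in> Lip \<Delta>"
  shows "\<bar>f x\<bar> \<le> 1" "\<bar>f x - f y\<bar> \<le> \<Delta> x y"
  using assms by (auto simp: Lip_def abs_le_iff minus_le_iff image_subset_iff)

lemma Lip_ucb: "uc_pseudometric \<Delta> \<Longrightarrow> f \<in> Lip \<Delta> \<Longrightarrow> f \<in> ucb_funs"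
  using Lip_subset_ucb_funs by blast

lemma Lip_zero: "uc_pseudometric \<Delta> \<Longrightarrow> (\<lambda>x. 0) \<in> Lip \<Delta>"
  by (rule LipI) (auto simp: uc_pseudometricD)

lemma Lip_uminus: "f \<in> Lip \<Delta> \<Longrightarrow> (\<lambda>x. - f x) \<in> Lip \<Delta>"
  by (rule LipI) (auto dest: LipD(1) simp: abs_minus_commute intro: order_trans[OF _ LipD(2)])

lemma Lip_mono:
  assumes "f \<in> Lip \<Delta>" "\<And>x y. \<Delta> x y \<le> \<Delta>' x y"
  shows "f \<in> Lip \<Delta>'"
  by (rule LipI) (use assms in \<open>auto dest: LipD(1) intro: order_trans[OF LipD(2)]\<close>)

lemma Lip_convex:
  assumes "f \<in> Lip \<Delta>" "g \<in> Lip \<Delta>" "0 \<le> t" "t \<le> 1"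
  shows "(\<lambda>x. (1 - t) * f x + t * g x) \<in> Lip \<Delta>"
proof (rule LipI)
  have conv: "\<bar>(1 - t) * a + t * b\<bar> \<le> c" if "\<bar>a\<bar> \<le> c" "\<bar>b\<bar> \<le> c" for a b c
  proof -
    have "\<bar>(1 - t) * a + t * b\<bar> \<le> (1 - t) * \<bar>a\<bar> + t * \<bar>b\<bar>"
      using assms abs_triangle_ineq[of "(1 - t) * a" "t * b"] by (simp add: abs_mult)
    also have "\<dots> \<le> (1 - t) * c + t * c"
      using assms that by (intro add_mono mult_left_mono) auto
    finally show ?thesis by (simp add: algebra_simps)
  qed
  show "\<bar>(1 - t) * f x + t * g x\<bar> \<le> 1" for x
    using conv[OF LipD(1)[OF assms(1)] LipD(1)[OF assms(2)], of x x] .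
  show "\<bar>(1 - t) * f x + t * g x - ((1 - t) * f y + t * g y)\<bar> \<le> \<Delta> x y" for x y
    using conv[OF LipD(2)[OF assms(1)] LipD(2)[OF assms(2)], of x y] by (simp add: algebra_simps)
qed

text \<open>A single function, rescaled, is Lipschitz for the pseudometric that it induces, so that
  statements about the sets \<open>Lip \<Delta>\<close> cover all of \<open>ucb_funs\<close>.\<close>

lemma ucb_funs_Lip:
  assumes "f \<in> ucb_funs"
  obtains \<Delta> c where "uc_pseudometric \<Delta>" "0 < c" "(\<lambda>x. f x / c) \<in> Lip \<Delta>"
proof -
  obtain b where b: "0 < b" "\<And>x. \<bar>f x\<bar> \<le> b" using ucb_funs_bounded[OF assms] by blast
  define \<Delta> where "\<Delta> = (\<lambda>x y. \<bar>f x / b - f y / b\<bar>)"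
  have u: "(\<lambda>x. f x / b) \<in> ucb_funs" using ucb_fun_scale[OF assms, of "1 / b"] by simp
  have "uc_pseudometric \<Delta>"
    unfolding \<Delta>_def
  proof (rule uc_pseudometricI)
    fix e :: real assume "e > 0"
    then show "eventually (\<lambda>(x, y). \<bar>f x / b - f y / b\<bar> < e) uniformity"
      using u by (auto simp: ucb_funs_def uniformly_continuous_real_iff)
  qed auto
  moreover have "(\<lambda>x. f x / b) \<in> Lip \<Delta>"
    using b by (intro LipI) (auto simp: \<Delta>_def)
  ultimately show ?thesis using b(1) that by blast
qed

lemma Lip_normalize:
  assumes "c > 0" "\<And>x. \<bar>F x\<bar> \<le> c" "\<And>x y. \<bar>F x - F y\<bar> \<le> c * \<Delta> x y"
  shows "(\<lambda>x. F x / c) \<in> Lip \<Delta>"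
proof (rule LipI)
  show "\<bar>F x / c\<bar> \<le> 1" for x using assms by simp
  have "\<bar>F x / c - F y / c\<bar> = \<bar>F x - F y\<bar> / c" for x y
    using assms(1) by (simp add: diff_divide_distrib[symmetric])
  then show "\<bar>F x / c - F y / c\<bar> \<le> \<Delta> x y" for x y
    using assms(1,3) by (simp add: pos_divide_le_eq mult.commute)
qed

lemma pair_normalize:
  assumes "(\<lambda>x. F x / c) \<in> ucb_funs" "c > 0"
  shows "pair \<mu> F = c * pair \<mu> (\<lambda>x. F x / c)" "F \<in> ucb_funs"
  using pair_scale[OF assms(1), of \<mu> c] ucb_fun_scale[OF assms(1), of c] assms(2) by simp_all

section \<open>Pointwise convergence and compactness\<close>

lemma open_fun_finite_coordinates:
  fixes U :: "('i \<Rightarrow> real) set"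
  assumes "open U" "p \<in> U"
  obtains K d where "finite K" "0 < d" "\<And>q. (\<And>i. i \<in> K \<Longrightarrow> \<bar>q i - p i\<bar> < d) \<Longrightarrow> q \<in> U"
proof -
  have "openin (product_topology (\<lambda>i. euclidean) UNIV) U"
    using assms(1) by (simp add: euclidean_product_topology)
  from product_topology_open_contains_basis[OF this assms(2)]
  obtain X where X: "p \<in> (\<Pi>\<^sub>E i\<in>UNIV. X i)" "\<And>i. open (X i)" "finite {i. X i \<noteq> UNIV}"
    "(\<Pi>\<^sub>E i\<in>UNIV. X i) \<subseteq> U" by auto
  have "\<exists>r>0. \<forall>t. \<bar>t - p i\<bar> < r \<longrightarrow> t \<in> X i" for i
  proof -
    have "p i \<in> X i" using X(1) by auto
    then show ?thesis
      using X(2)[of i, unfolded open_dist dist_real_def] by blast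
  qed
  then obtain r where r: "\<And>i. r i > 0" "\<And>i t. \<bar>t - p i\<bar> < r i \<Longrightarrow> t \<in> X i" by metis
  define d where "d = Min (insert 1 (r ` {i. X i \<noteq> UNIV}))"
  have "d > 0" using X(3) r(1) by (auto simp: d_def)
  moreover have "q \<in> U" if q: "\<And>i. i \<in> {i. X i \<noteq> UNIV} \<Longrightarrow> \<bar>q i - p i\<bar> < d" for q
  proof -
    have "q i \<in> X i" for i
    proof (cases "X i = UNIV")
      case False
      then have "d \<le> r i" using X(3) by (auto simp: d_def)
      then show ?thesis using q[of i] False r(2)[of "q i" i] by simp
    qed simp
    then show ?thesis using X(4) by auto
  qed
  ultimately show ?thesis using X(3) that by blast
qed

lemma tendsto_fun_coordinatewise:
  fixes \<Phi> :: "'t \<Rightarrow> 'i \<Rightarrow> real"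
  assumes "\<And>i. ((\<lambda>t. \<Phi> t i) \<longlongrightarrow> F i) net"
  shows "(\<Phi> \<longlongrightarrow> F) net"
proof -
  have "limitin (product_topology (\<lambda>i. euclidean) UNIV) \<Phi> F net"
    unfolding limitin_componentwise using assms by simp
  then show ?thesis by (simp add: euclidean_product_topology)
qed

lemma tendsto_coordinate:
  fixes \<Phi> :: "'t \<Rightarrow> 'i \<Rightarrow> real"
  assumes "(\<Phi> \<longlongrightarrow> F) net"
  shows "((\<lambda>t. \<Phi> t i) \<longlongrightarrow> F i) net"
proof -
  have "limitin (product_topology (\<lambda>i. euclidean) UNIV) \<Phi> F net"
    using assms by (simp add: euclidean_product_topology)
  then show ?thesis unfolding limitin_componentwise by simp
qed

lemma compact_Lip: "compact (Lip \<Delta>)"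
proof -
  have "compactin (product_topology (\<lambda>i::'a. euclidean) UNIV) (\<Pi>\<^sub>E i\<in>UNIV. {-1..1::real})"
    by (simp add: compactin_PiE)
  then have c: "compact (\<Pi>\<^sub>E i\<in>(UNIV::'a set). {-1..1::real})"
    by (simp add: euclidean_product_topology)
  have coord: "continuous_on UNIV (\<lambda>f::'a \<Rightarrow> real. f x)" for x
    by (rule continuous_on_product_coordinates)
  have "closed {f. \<bar>f x - f y\<bar> \<le> \<Delta> x y}" for x y
    by (intro closed_Collect_le continuous_intros coord)
  then have "closed (\<Inter>x. \<Inter>y. {f. \<bar>f x - f y\<bar> \<le> \<Delta> x y})" by blast
  with c have "compact ((\<Pi>\<^sub>E i\<in>UNIV. {-1..1}) \<inter> (\<Inter>x. \<Inter>y. {f. \<bar>f x - f y\<bar> \<le> \<Delta> x y}))"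
    by (rule compact_Int_closed)
  also have "(\<Pi>\<^sub>E i\<in>UNIV. {-1..1}) \<inter> (\<Inter>x. \<Inter>y. {f. \<bar>f x - f y\<bar> \<le> \<Delta> x y}) = Lip \<Delta>"
    by (auto simp: Lip_def PiE_iff image_subset_iff)
  finally show ?thesis .
qed

text \<open>By compactness, \<open>Lip \<Delta>\<close> is totally bounded for the uniformity of pointwise convergence.\<close>

lemma Lip_finite_net:
  assumes "finite K" "0 < e"
  obtains T where "finite T" "T \<subseteq> Lip \<Delta>" "\<And>f. f \<in> Lip \<Delta> \<Longrightarrow> \<exists>g\<in>T. \<forall>x\<in>K. \<bar>f x - g x\<bar> < e"
proof -
  define N where "N g = (\<Inter>x\<in>K. {f. \<bar>f x - g x\<bar> < e})" for g :: "'a \<Rightarrow> real"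
  have "open {f. \<bar>f x - g x\<bar> < e}" for x and g :: "'a \<Rightarrow> real"
    by (intro open_Collect_less continuous_intros continuous_on_product_coordinates)
  then have "open (N g)" for g
    unfolding N_def using assms(1) by (intro open_INT) auto
  moreover have "Lip \<Delta> \<subseteq> (\<Union>g\<in>Lip \<Delta>. N g)"
    using assms(2) by (auto simp: N_def)
  ultimately obtain T where T: "T \<subseteq> Lip \<Delta>" "finite T" "Lip \<Delta> \<subseteq> (\<Union>g\<in>T. N g)"
    using compactE_image[OF compact_Lip] by metis
  show ?thesis
  proof (rule that[OF T(2,1)])
    fix f assume "f \<in> Lip \<Delta>"
    then obtain g where "g \<in> T" "f \<in> N g" using T(3) by blast
    then show "\<exists>g\<in>T. \<forall>x\<in>K. \<bar>f x - g x\<bar> < e" by (auto simp: N_def)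
  qed
qed

section \<open>Functionals continuous on sets of Lipschitz functions\<close>

lemma Mu_tendsto:
  assumes "\<mu> \<in> Mu" "uc_pseudometric \<Delta>" "0 < c"
    and lim: "\<And>x. ((\<lambda>t. \<Phi> t x) \<longlongrightarrow> F x) net"
    and F: "(\<lambda>x. F x / c) \<in> Lip \<Delta>"
    and \<Phi>: "eventually (\<lambda>t. (\<lambda>x. \<Phi> t x / c) \<in> Lip \<Delta>) net"
  shows "((\<lambda>t. pair \<mu> (\<Phi> t)) \<longlongrightarrow> pair \<mu> F) net"
proof -
  have "((\<lambda>t x. \<Phi> t x / c) \<longlongrightarrow> (\<lambda>x. F x / c)) net"
    by (intro tendsto_fun_coordinatewise tendsto_intros lim) (use \<open>0 < c\<close> in auto)
  moreover have "continuous_on (Lip \<Delta>) (\<lambda>f. pair \<mu> f)"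
    using assms(1,2) by (auto simp: Mu_def)
  ultimately have "((\<lambda>t. pair \<mu> (\<lambda>x. \<Phi> t x / c)) \<longlongrightarrow> pair \<mu> (\<lambda>x. F x / c)) net"
    using F \<Phi> by (intro continuous_on_tendsto_compose[where f = "\<lambda>f. pair \<mu> f"])
  then have "((\<lambda>t. c * pair \<mu> (\<lambda>x. \<Phi> t x / c)) \<longlongrightarrow> c * pair \<mu> (\<lambda>x. F x / c)) net"
    by (rule tendsto_mult_left)
  moreover have "c * pair \<mu> (\<lambda>x. F x / c) = pair \<mu> F"
    using pair_normalize(1)[OF Lip_ucb[OF assms(2) F]] \<open>0 < c\<close> by simp
  moreover have "eventually (\<lambda>t. c * pair \<mu> (\<lambda>x. \<Phi> t x / c) = pair \<mu> (\<Phi> t)) net"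
    using \<Phi> by eventually_elim (use pair_normalize(1) Lip_ucb[OF assms(2)] \<open>0 < c\<close> in metis)
  ultimately show ?thesis using tendsto_cong by force
qed

text \<open>Continuity at \<open>0\<close> for pointwise convergence, in terms of basic neighbourhoods.\<close>

lemma Mu_small_on_finite:
  assumes "\<mu> \<in> Mu" "uc_pseudometric \<Delta>" "0 < e"
  obtains K d where "finite K" "0 < d"
    "\<And>F. F \<in> Lip \<Delta> \<Longrightarrow> (\<And>x. x \<in> K \<Longrightarrow> \<bar>F x\<bar> < d) \<Longrightarrow> \<bar>pair \<mu> F\<bar> < e"
proof -
  have "continuous_on (Lip \<Delta>) (\<lambda>f. pair \<mu> f)"
    using assms(1,2) by (auto simp: Mu_def)
  then obtain U where U: "open U" "U \<inter> Lip \<Delta> = (\<lambda>f. pair \<mu> f) -` {-e<..<e} \<inter> Lip \<Delta>"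
    unfolding continuous_on_open_invariant using open_greaterThanLessThan by metis
  have "pair \<mu> (\<lambda>x. 0) = 0"
    using pair_scale[OF ucb_fun_const, of \<mu> 0 0] by simp
  then have "(\<lambda>x. 0) \<in> U"
    using U(2) Lip_zero[OF assms(2)] assms(3) by auto
  with U(1) obtain K d where K: "finite K" "0 < d"
    "\<And>q. (\<And>i. i \<in> K \<Longrightarrow> \<bar>q i - 0\<bar> < d) \<Longrightarrow> q \<in> U"
    using open_fun_finite_coordinates by metis
  show ?thesis
  proof (rule that[OF K(1,2)])
    fix F assume "F \<in> Lip \<Delta>" "\<And>x. x \<in> K \<Longrightarrow> \<bar>F x\<bar> < d"
    then have "F \<in> U \<inter> Lip \<Delta>" using K(3) by simp
    then show "\<bar>pair \<mu> F\<bar> < e" using U(2) by auto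
  qed
qed

lemma Mu_diff: "\<mu> \<in> Mu \<Longrightarrow> \<nu> \<in> Mu \<Longrightarrow> \<mu> - \<nu> \<in> Mu"
  by (auto simp: Mu_def blinfun.diff_left intro!: continuous_on_diff)

text \<open>The first-order condition at a minimum over a convex set: \<open>2 t A + t\<^sup>2 B\<close> is the increment of a
quadratic function along a segment.\<close>

lemma nonneg_linear_coefficient:
  fixes A B :: real
  assumes "\<And>t. 0 < t \<Longrightarrow> t \<le> 1 \<Longrightarrow> 0 \<le> 2 * t * A + t\<^sup>2 * B"
  shows "0 \<le> A"
proof (rule ccontr)
  assume "\<not> 0 \<le> A"
  then have A: "A < 0" by simp
  define t where "t = min 1 (- A / (\<bar>B\<bar> + 1))"
  have t: "0 < t" "t \<le> 1" using A by (auto simp: t_def divide_neg_pos)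
  have "t * B \<le> t * (\<bar>B\<bar> + 1)" using t by (intro mult_left_mono) auto
  also have "t * (\<bar>B\<bar> + 1) \<le> - A" 
    using mult_right_mono[of t "- A / (\<bar>B\<bar> + 1)" "\<bar>B\<bar> + 1"] by (simp add: t_def)
  finally have "2 * A + t * B < 0" using A by simp
  then have "t * (2 * A + t * B) < 0" using t(1) by (rule mult_pos_neg[rotated])
  then show False using assms[OF t] by (simp add: algebra_simps power2_eq_square)
qed

text \<open>This is a separation argument. Choose a finite set \<open>K\<close> such that \<open>\<mu>\<close> is smaller than \<open>e\<close> on the
members of \<open>Lip \<Delta>\<close> vanishing on \<open>K\<close>. Then the compact convex set of all pairs
\<open>(\<mu> f, f|K)\<close> with \<open>f \<in> Lip \<Delta>\<close> does not contain \<open>(e, 0)\<close>. A hyperplane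
separating it from that point expresses \<open>\<mu> f\<close> up to \<open>e\<close> as a linear combination of the values of
\<open>f\<close> on \<open>K\<close>. The hyperplane is orthogonal to the segment from \<open>(e, 0)\<close> to the nearest point of the
set; \<open>Q\<close> is the squared distance and \<open>g\<close> is a function giving that nearest point.\<close>

lemma Mu_molecular_approximation:
  fixes \<mu> :: "'a::uniform_space dual"
  assumes "\<mu> \<in> Mu" "uc_pseudometric \<Delta>" "0 < e"
  obtains K c where "finite K" "\<And>f. f \<in> Lip \<Delta> \<Longrightarrow> \<bar>pair \<mu> f - (\<Sum>x\<in>K. c x * f x)\<bar> \<le> e"
proof -
  obtain K d where K: "finite K" "0 < d"
    "\<And>F. F \<in> Lip \<Delta> \<Longrightarrow> (\<And>x. x \<in> K \<Longrightarrow> \<bar>F x\<bar> < d) \<Longrightarrow> \<bar>pair \<mu> F\<bar> < e"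
    using Mu_small_on_finite[OF assms] by blast
  define Q where "Q f = (pair \<mu> f - e)\<^sup>2 + (\<Sum>x\<in>K. (f x)\<^sup>2)" for f :: "'a \<Rightarrow> real"
  have "continuous_on (Lip \<Delta>) (\<lambda>f. pair \<mu> f)"
    using assms(1,2) by (auto simp: Mu_def)
  moreover have "continuous_on (Lip \<Delta>) (\<lambda>f::'a \<Rightarrow> real. f x)" for x
    by (rule continuous_on_subset[OF continuous_on_product_coordinates]) simp
  ultimately have "continuous_on (Lip \<Delta>) Q"
    unfolding Q_def
    by (intro continuous_on_add continuous_on_power continuous_on_diff continuous_on_sum
        continuous_on_const)
  then obtain g where g: "g \<in> Lip \<Delta>" "\<And>f. f \<in> Lip \<Delta> \<Longrightarrow> Q g \<le> Q f"
    using continuous_attains_inf[OF compact_Lip, of \<Delta> Q] Lip_zero[OF assms(2)] by blast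
  define s where "s = e - pair \<mu> g"
  have gu: "g \<in> ucb_funs" using Lip_ucb[OF assms(2) g(1)] .
  have Qpos: "0 < Q g"
  proof (rule ccontr)
    assume "\<not> 0 < Q g"
    moreover have "0 \<le> (\<Sum>x\<in>K. (g x)\<^sup>2)" "0 \<le> (pair \<mu> g - e)\<^sup>2" by (simp_all add: sum_nonneg)
    ultimately have "(pair \<mu> g - e)\<^sup>2 = 0" "(\<Sum>x\<in>K. (g x)\<^sup>2) = 0"
      unfolding Q_def by linarith+
    then have "pair \<mu> g = e" "\<And>x. x \<in> K \<Longrightarrow> g x = 0"
      using K(1) by (auto simp: sum_nonneg_eq_0_iff)
    then show False using K(2) K(3)[OF g(1)] assms(3) by auto
  qed
  (* The set lies on the far side of the hyperplane through its nearest point. *)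
  have key: "s * pair \<mu> f - (\<Sum>x\<in>K. g x * f x) \<le> e * s - Q g" if f: "f \<in> Lip \<Delta>" for f
  proof -
    have fu: "f \<in> ucb_funs" using Lip_ucb[OF assms(2) f] .
    define A where "A = - s * (pair \<mu> f - pair \<mu> g) + (\<Sum>x\<in>K. g x * (f x - g x))"
    define B where "B = (pair \<mu> f - pair \<mu> g)\<^sup>2 + (\<Sum>x\<in>K. (f x - g x)\<^sup>2)"
    have "0 \<le> A"
    proof (rule nonneg_linear_coefficient)
      fix t :: real assume t: "0 < t" "t \<le> 1"
      let ?h = "\<lambda>x. (1 - t) * g x + t * f x"
      have h: "?h \<in> Lip \<Delta>" using Lip_convex[OF g(1) f] t by simp
      have p: "pair \<mu> ?h = (1 - t) * pair \<mu> g + t * pair \<mu> f"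
        by (simp add: pair_add pair_scale ucb_fun_scale fu gu)
      have "(pair \<mu> ?h - e)\<^sup>2 = (pair \<mu> g - e)\<^sup>2 + 2 * t * (- s * (pair \<mu> f - pair \<mu> g))
        + t\<^sup>2 * (pair \<mu> f - pair \<mu> g)\<^sup>2"
        unfolding p s_def by (simp add: power2_eq_square algebra_simps)
      moreover have "(\<Sum>x\<in>K. (?h x)\<^sup>2) = (\<Sum>x\<in>K. (g x)\<^sup>2)
          + 2 * t * (\<Sum>x\<in>K. g x * (f x - g x)) + t\<^sup>2 * (\<Sum>x\<in>K. (f x - g x)\<^sup>2)"
        unfolding sum_distrib_left sum.distrib[symmetric]
        by (rule sum.cong) (simp_all add: power2_eq_square algebra_simps)
      ultimately have "Q ?h = Q g + 2 * t * A + t\<^sup>2 * B"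
        unfolding Q_def A_def B_def by algebra
      then show "0 \<le> 2 * t * A + t\<^sup>2 * B" using g(2)[OF h] by simp
    qed
    moreover have "(\<Sum>x\<in>K. g x * (f x - g x)) = (\<Sum>x\<in>K. g x * f x) - (\<Sum>x\<in>K. (g x)\<^sup>2)"
      by (simp add: right_diff_distrib sum_subtractf power2_eq_square)
    moreover have "Q g = s\<^sup>2 + (\<Sum>x\<in>K. (g x)\<^sup>2)"
      by (simp add: Q_def s_def power2_commute)
    moreover have "s * pair \<mu> g = e * s - s\<^sup>2"
      by (simp add: s_def power2_eq_square algebra_simps)
    ultimately show ?thesis by (simp add: A_def algebra_simps)
  qed
  have z: "pair \<mu> (\<lambda>x. 0) = 0"
    using pair_scale[OF ucb_fun_const, of \<mu> 0 0] by simp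
  (* The origin belongs to the set, which determines on which side of 0 the coefficient s lies. *)
  have "0 < e * s" using key[OF Lip_zero[OF assms(2)]] z Qpos by simp
  then have s: "0 < s" using assms(3) by (simp add: zero_less_mult_iff)
  show ?thesis
  proof (rule that[OF K(1), of "\<lambda>x. g x / s"])
    fix f assume f: "f \<in> Lip \<Delta>"
    have m: "pair \<mu> (\<lambda>x. - f x) = - pair \<mu> f"
      using pair_scale[OF Lip_ucb[OF assms(2) f], of \<mu> "- 1"] by simp
    have "\<bar>s * pair \<mu> f - (\<Sum>x\<in>K. g x * f x)\<bar> \<le> e * s"
      using key[OF f] key[OF Lip_uminus[OF f]] Qpos m by (simp add: sum_negf)
    moreover have "s * pair \<mu> f - (\<Sum>x\<in>K. g x * f x) = s * (pair \<mu> f - (\<Sum>x\<in>K. g x / s * f x))"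
      using s by (simp add: right_diff_distrib sum_distrib_left)
    ultimately show "\<bar>pair \<mu> f - (\<Sum>x\<in>K. g x / s * f x)\<bar> \<le> e"
      using s by (simp add: abs_mult mult.commute)
  qed
qed

section \<open>Completeness and uniform boundedness\<close>

lemma ucb_fun_uniform_limit:
  assumes "\<And>e. 0 < e \<Longrightarrow> \<exists>g\<in>ucb_funs. \<forall>x. \<bar>g x - F x\<bar> \<le> e"
  shows "F \<in> ucb_funs"
proof -
  have "eventually (\<lambda>(x, y). \<bar>F x - F y\<bar> < e) uniformity" if e: "e > 0" for e
  proof -
    obtain g where g: "g \<in> ucb_funs" "\<And>x. \<bar>g x - F x\<bar> \<le> e / 4"
      using assms[of "e / 4"] divide_pos_pos[OF e zero_less_numeral] by blast
    have "eventually (\<lambda>(x, y). \<bar>g x - g y\<bar> < e / 4) uniformity"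
      using g(1) divide_pos_pos[OF e zero_less_numeral]
      unfolding ucb_funs_def uniformly_continuous_real_iff by blast
    then show ?thesis
    proof eventually_elim
      case (elim p)
      then show ?case
        using g(2)[of "fst p"] g(2)[of "snd p"] e unfolding case_prod_unfold by linarith
    qed
  qed
  moreover have "bounded (range F)"
  proof -
    obtain g where g: "g \<in> ucb_funs" "\<And>x. \<bar>g x - F x\<bar> \<le> 1"
      using assms[of 1] by auto
    obtain b where "\<And>x. \<bar>g x\<bar> \<le> b" using ucb_funs_bounded[OF g(1)] by blast
    then have "norm (F x) \<le> b + 1" for x
      using g(2)[of x] by (smt (verit) real_norm_def)
    then show ?thesis by (intro boundedI) auto
  qed
  ultimately show ?thesis by (simp add: ucb_funs_def uniformly_continuous_real_iff)
qed

instance ucb :: (uniform_space) banach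
proof
  fix X :: "nat \<Rightarrow> 'a ucb"
  assume X: "Cauchy X"
  have le: "\<bar>apply_ucb (X m) x - apply_ucb (X n) x\<bar> \<le> dist (X m) (X n)" for m n x
    using abs_apply_ucb_le_norm[of "X m - X n" x] by (simp add: dist_norm)
  have "Cauchy (\<lambda>n. apply_ucb (X n) x)" for x
    using X le unfolding Cauchy_def dist_real_def by (meson le_less_trans)
  then have "\<exists>l. (\<lambda>n. apply_ucb (X n) x) \<longlonglongrightarrow> l" for x
    by (simp add: Cauchy_convergent_iff convergent_def)
  then obtain F where F: "\<And>x. (\<lambda>n. apply_ucb (X n) x) \<longlonglongrightarrow> F x" by metis
  have unif: "\<exists>N. \<forall>n\<ge>N. \<forall>x. \<bar>apply_ucb (X n) x - F x\<bar> \<le> e" if e: "e > 0" for e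
  proof -
    obtain N where N: "\<And>m n. m \<ge> N \<Longrightarrow> n \<ge> N \<Longrightarrow> dist (X m) (X n) < e"
      using X e unfolding Cauchy_def by blast
    have "\<bar>apply_ucb (X n) x - F x\<bar> \<le> e" if "n \<ge> N" for n x
    proof (rule tendsto_upperbound)
      show "(\<lambda>m. \<bar>apply_ucb (X n) x - apply_ucb (X m) x\<bar>) \<longlonglongrightarrow> \<bar>apply_ucb (X n) x - F x\<bar>"
        by (intro tendsto_intros F)
      show "\<forall>\<^sub>F m in sequentially. \<bar>apply_ucb (X n) x - apply_ucb (X m) x\<bar> \<le> e"
        using eventually_ge_at_top[of N]
        by eventually_elim (use le N that in \<open>meson le_less_trans less_imp_le\<close>)
    qed simp
    then show ?thesis by blast
  qed
  have "F \<in> ucb_funs"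
  proof (rule ucb_fun_uniform_limit)
    show "\<exists>g\<in>ucb_funs. \<forall>x. \<bar>g x - F x\<bar> \<le> e" if "e > 0" for e
      using unif[OF that] apply_ucb by blast
  qed
  then have app: "apply_ucb (Ucb F) = F" by (rule Ucb_inverse)
  have "X \<longlonglongrightarrow> Ucb F"
    unfolding LIMSEQ_def
  proof (intro allI impI)
    fix e :: real assume "e > 0"
    then obtain N where N: "\<forall>n\<ge>N. \<forall>x. \<bar>apply_ucb (X n) x - F x\<bar> \<le> e / 2"
      using unif[of "e / 2"] by auto
    have "dist (X n) (Ucb F) < e" if "n \<ge> N" for n
    proof -
      have "norm (X n - Ucb F) \<le> e / 2"
        using N that by (intro norm_ucb_le) (simp add: app)
      then show ?thesis using \<open>e > 0\<close> by (simp add: dist_norm)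
    qed
    then show "\<exists>N. \<forall>n\<ge>N. dist (X n) (Ucb F) < e" by blast
  qed
  then show "convergent X" by (auto simp: convergent_def)
qed

text \<open>By Baire's theorem one of the closed sets \<open>A N\<close>, on which all \<open>T n\<close> are bounded by \<open>N\<close>, contains a
ball, and linearity carries the bound to the unit ball.\<close>

lemma uniform_boundedness:
  fixes T :: "nat \<Rightarrow> 'a::banach \<Rightarrow>\<^sub>L 'b::real_normed_vector"
  assumes "\<And>f. bounded (range (\<lambda>n. blinfun_apply (T n) f))"
  obtains C where "\<And>n. norm (T n) \<le> C"
proof -
  define A where "A N = {f. \<forall>n. norm (blinfun_apply (T n) f) \<le> real N}" for N :: nat
  have closed: "closed (A N)" for N
    unfolding A_def by (intro closed_Collect_all closed_Collect_le continuous_intros)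
  have un: "\<Union>(range A) = UNIV"
  proof -
    have "\<exists>N. f \<in> A N" for f
    proof -
      obtain b where b: "\<And>n. norm (blinfun_apply (T n) f) \<le> b"
        using assms[of f] by (auto simp: bounded_iff)
      moreover obtain N where "b \<le> real N" using real_arch_simple by blast
      ultimately show ?thesis unfolding A_def using order_trans by blast
    qed
    then show ?thesis by auto
  qed
  have "\<exists>N. interior (A N) \<noteq> {}"
  proof (rule ccontr)
    assume "\<nexists>N. interior (A N) \<noteq> {}"
    then have "euclidean interior_of \<Union>(range A) = {}"
      using closed
      by (intro Baire_category_alt) (auto simp: completely_metrizable_space_euclidean)
    then show False by (simp add: un)
  qed
  then obtain N f r where r: "0 < r" "cball f r \<subseteq> A N"
    using mem_interior_cball by blast
  have "norm (blinfun_apply (T n) h) \<le> 2 * real N / r * norm h" for n h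
  proof (cases "h = 0")
    case False
    define u where "u = (r / norm h) *\<^sub>R h"
    have "norm u = r" using False r(1) by (simp add: u_def)
    then have "f + u \<in> A N" "f \<in> A N" using r by (auto simp: dist_norm subset_iff)
    then have "norm (blinfun_apply (T n) (f + u)) \<le> N" "norm (blinfun_apply (T n) f) \<le> N"
      by (auto simp: A_def)
    then have "norm (blinfun_apply (T n) u) \<le> 2 * N"
      using norm_triangle_ineq4[of "blinfun_apply (T n) (f + u)" "blinfun_apply (T n) f"]
      by (simp add: blinfun.add_right)
    moreover have "norm (blinfun_apply (T n) u) = r / norm h * norm (blinfun_apply (T n) h)"
      using r(1) by (simp add: u_def blinfun.scaleR_right)
    ultimately show ?thesis using r(1) False by (simp add: field_simps)
  qed simp
  then have "norm (T n) \<le> 2 * real N / r" for n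
    using r(1) by (intro norm_blinfun_bound) auto
  then show ?thesis by (rule that)
qed

section \<open>Weak* null sequences converge uniformly on Lipschitz functions\<close>

text \<open>The least \<open>\<Delta>\<close>-Lipschitz function that is at least \<open>u\<close> on \<open>K\<close> (McShane's extension). With \<open>u = 0\<close> it
is minus the distance to \<open>K\<close>; applied to \<open>- u\<close> and negated it gives the greatest extension.\<close>

definition lip_extension :: "('a \<Rightarrow> 'a \<Rightarrow> real) \<Rightarrow> 'a set \<Rightarrow> ('a \<Rightarrow> real) \<Rightarrow> 'a \<Rightarrow> real" where
  "lip_extension \<Delta> K u x = (MAX k\<in>K. u k - \<Delta> x k)"

context
  fixes \<Delta> :: "'a::uniform_space \<Rightarrow> 'a \<Rightarrow> real" and K :: "'a set"
  assumes \<Delta>: "uc_pseudometric \<Delta>" and K: "finite K" "K \<noteq> {}"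
begin

lemma lip_extension_ge: "k \<in> K \<Longrightarrow> u k - \<Delta> x k \<le> lip_extension \<Delta> K u x"
  unfolding lip_extension_def using K by simp

lemma lip_extension_attained: "\<exists>k\<in>K. lip_extension \<Delta> K u x = u k - \<Delta> x k"
proof -
  have "lip_extension \<Delta> K u x \<in> (\<lambda>k. u k - \<Delta> x k) ` K"
    unfolding lip_extension_def using K by (intro Max_in) auto
  then show ?thesis by auto
qed

lemma lip_extension_lipschitz:
  "\<bar>lip_extension \<Delta> K u x - lip_extension \<Delta> K u y\<bar> \<le> \<Delta> x y"
proof -
  have le: "lip_extension \<Delta> K u x \<le> lip_extension \<Delta> K u y + \<Delta> x y" for x y
  proof -
    obtain k where k: "k \<in> K" "lip_extension \<Delta> K u x = u k - \<Delta> x k"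
      using lip_extension_attained by blast
    then show ?thesis
      using lip_extension_ge[OF k(1), of u y] uc_pseudometricD(4)[OF \<Delta>, of y k x]
        uc_pseudometricD(3)[OF \<Delta>, of x y] by linarith
  qed
  show ?thesis
    using le[of x y] le[of y x] uc_pseudometricD(3)[OF \<Delta>, of x y] by linarith
qed

lemma lip_extension_eq:
  assumes "k \<in> K" "\<And>x y. \<bar>u x - u y\<bar> \<le> \<Delta> x y"
  shows "lip_extension \<Delta> K u k = u k"
proof (rule antisym)
  obtain j where j: "lip_extension \<Delta> K u k = u j - \<Delta> k j"
    using lip_extension_attained by blast
  then show "lip_extension \<Delta> K u k \<le> u k"
    using assms(2)[of k j] by linarith
  show "u k \<le> lip_extension \<Delta> K u k"
    using lip_extension_ge[OF assms(1), of u k] uc_pseudometricD(2)[OF \<Delta>] by simp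
qed

end

text \<open>\<open>Lip \<Delta>\<close> is in general not metrizable for pointwise convergence, so Baire's theorem is applied to it
as a compact regular space.\<close>

lemma regular_space_top_of_Lip: "regular_space (top_of_set (Lip \<Delta>))"
proof -
  have "regular_space (product_topology (\<lambda>i::'a. euclideanreal) UNIV)"
    by (simp add: regular_space_product_topology metrizable_imp_regular_space
        metrizable_space_euclidean)
  then show ?thesis
    by (intro regular_space_subtopology) (simp add: euclidean_product_topology)
qed

lemma clamp_lipschitz:
  fixes a b c a' b' c' \<delta> :: real
  assumes "\<bar>a - a'\<bar> \<le> \<delta>" "\<bar>b - b'\<bar> \<le> \<delta>" "\<bar>c - c'\<bar> \<le> \<delta>"
  shows "\<bar>max a (min b c) - max a' (min b' c')\<bar> \<le> \<delta>"
  using assms by (auto simp: max_def min_def abs_le_iff)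

text \<open>Let \<open>D = (2 / r) \<Delta>\<close> for a small scale \<open>r\<close>. By Baire's theorem on \<open>Lip D\<close> there are \<open>f0 \<in> Lip D\<close>, a
finite set \<open>K\<close> and \<open>N\<close> such that \<open>\<kappa> n\<close>, for \<open>n \<ge> N\<close>, is small on all functions in \<open>Lip D\<close> that
agree with \<open>f0\<close> on \<open>K\<close>. Any \<open>f \<in> Lip \<Delta>\<close> can be turned into such a function: clamp it between the
least and the greatest \<open>D\<close>-Lipschitz extensions of the restriction of \<open>f0\<close> to \<open>K\<close>. These extensions
are below \<open>-1\<close> and above \<open>1\<close> at distance at least \<open>r\<close> from \<open>K\<close>, because \<open>D\<close> is so steep; hence clamping
changes \<open>f\<close> only within distance \<open>r\<close> of \<open>K\<close>. If \<open>g\<close> is one of finitely many functions in \<open>Lip \<Delta>\<close>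
that approximate all members of \<open>Lip \<Delta>\<close> on \<open>K\<close>, and is within \<open>r\<close> of \<open>f\<close> there, then \<open>f - g\<close>
differs from the difference of the clamped functions by at most \<open>6 r\<close>. So \<open>\<kappa> n f\<close> is small, since
\<open>\<kappa> n g\<close> tends to \<open>0\<close> for each of the finitely many \<open>g\<close>.\<close>

lemma Mu_weak_star_null_sequence_uniform_on_Lip:
  fixes \<kappa> :: "nat \<Rightarrow> 'a::uniform_space dual"
  assumes Mu: "\<And>n. \<kappa> n \<in> Mu" and C: "\<And>n. norm (\<kappa> n) \<le> C"
    and null: "\<And>f. f \<in> ucb_funs \<Longrightarrow> (\<lambda>n. pair (\<kappa> n) f) \<longlonglongrightarrow> 0"
    and \<Delta>: "uc_pseudometric \<Delta>" and e: "0 < e"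
  shows "eventually (\<lambda>n. \<forall>f\<in>Lip \<Delta>. \<bar>pair (\<kappa> n) f\<bar> \<le> e) sequentially"
proof -
  have C0: "0 \<le> C" using C[of 0] norm_ge_zero order_trans by blast
  (* The error 6 r of the final comparison, times the norm bound C, has to be at most e / 4. *)
  define r where "r = min 1 (e / (24 * (C + 1)))"
  have r: "0 < r" "r \<le> 1" using e C0 by (auto simp: r_def)
  have rC: "C * (6 * r) \<le> e / 4"
  proof -
    have "C * (6 * r) \<le> (C + 1) * (6 * r)" using r by (intro mult_right_mono) auto
    also have "\<dots> \<le> (C + 1) * (6 * (e / (24 * (C + 1))))"
      using C0 by (intro mult_left_mono) (auto simp: r_def)
    also have "\<dots> = e / 4" using C0 by (simp add: field_simps)
    finally show ?thesis .
  qed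
  define D where "D x y = 2 / r * \<Delta> x y" for x y
  have D: "uc_pseudometric D"
    unfolding D_def using \<Delta> r by (intro uc_pseudometric_scale) auto
  have \<Delta>D: "\<Delta> x y \<le> D x y" for x y
    using uc_pseudometricD(1)[OF \<Delta>, of x y] r mult_right_mono[of 1 "2 / r" "\<Delta> x y"]
    by (simp add: D_def)
  define A where "A N = {f \<in> Lip D. \<forall>n\<ge>N. \<bar>pair (\<kappa> n) f\<bar> \<le> e / 8}" for N :: nat
  have cont: "continuous_on (Lip D) (\<lambda>f. pair (\<kappa> n) f)" for n
    using Mu D by (auto simp: Mu_def)
  have closed: "closedin (top_of_set (Lip D)) (A N)" for N
  proof -
    have "closedin (top_of_set (Lip D)) (\<Inter>n\<in>{N..}. Lip D \<inter> (\<lambda>f. pair (\<kappa> n) f) -` cball 0 (e / 8))"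
      by (intro closedin_INT continuous_closedin_preimage cont) auto
    also have "(\<Inter>n\<in>{N..}. Lip D \<inter> (\<lambda>f. pair (\<kappa> n) f) -` cball 0 (e / 8)) = A N"
      by (auto simp: A_def)
    finally show ?thesis .
  qed
  have un: "\<Union>(range A) = Lip D"
  proof
    show "Lip D \<subseteq> \<Union>(range A)"
    proof
      fix f assume f: "f \<in> Lip D"
      have "eventually (\<lambda>n. \<bar>pair (\<kappa> n) f\<bar> < e / 8) sequentially"
        using tendstoD[OF null[OF Lip_ucb[OF D f]], of "e / 8"] e by simp
      then obtain N where "\<forall>n\<ge>N. \<bar>pair (\<kappa> n) f\<bar> < e / 8"
        unfolding eventually_sequentially by blast
      then have "f \<in> A N" unfolding A_def using f less_imp_le by blast
      then show "f \<in> \<Union>(range A)" by blast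
    qed
  qed (auto simp: A_def)
  have "\<exists>N. top_of_set (Lip D) interior_of A N \<noteq> {}"
  proof (rule ccontr)
    assume "\<nexists>N. top_of_set (Lip D) interior_of A N \<noteq> {}"
    moreover have "locally_compact_space (top_of_set (Lip D))"
      by (intro compact_imp_locally_compact_space) (simp add: compact_space_subtopology compact_Lip)
    ultimately have "top_of_set (Lip D) interior_of \<Union>(range A) = {}"
      using closed regular_space_top_of_Lip by (intro Baire_category_alt) auto
    moreover have "top_of_set (Lip D) interior_of Lip D = Lip D"
      using interior_of_topspace[of "top_of_set (Lip D)"] by simp
    ultimately show False using Lip_zero[OF D] by (simp add: un)
  qed
  then obtain N f0 where f0: "f0 \<in> top_of_set (Lip D) interior_of A N" by blast
  have "openin (top_of_set (Lip D)) (top_of_set (Lip D) interior_of A N)" by simp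
  then obtain U where U: "open U" "top_of_set (Lip D) interior_of A N = Lip D \<inter> U"
    unfolding openin_open by blast
  have f0L: "f0 \<in> Lip D" and f0U: "f0 \<in> U" using f0 U(2) by auto
  have UA: "Lip D \<inter> U \<subseteq> A N" using interior_of_subset[of "top_of_set (Lip D)" "A N"] U(2) by simp
  obtain K0 d where K0: "finite K0" "0 < d" "\<And>q. (\<And>i. i \<in> K0 \<Longrightarrow> \<bar>q i - f0 i\<bar> < d) \<Longrightarrow> q \<in> U"
    using open_fun_finite_coordinates[OF U(1) f0U] by metis
  (* An arbitrary point is added because extensions are maxima over a nonempty set. *)
  define K where "K = insert undefined K0"
  have K: "finite K" "K \<noteq> {}" using K0 by (auto simp: K_def)
  define lo where "lo = lip_extension D K f0"
  define hi where "hi x = - lip_extension D K (\<lambda>x. - f0 x) x" for x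
  define clamp where "clamp f x = max (lo x) (min (f x) (hi x))" for f x
  have lo_lip: "\<bar>lo x - lo y\<bar> \<le> D x y" and hi_lip: "\<bar>hi x - hi y\<bar> \<le> D x y" for x y
    unfolding lo_def hi_def
    using lip_extension_lipschitz[OF D K, of f0 x y]
      lip_extension_lipschitz[OF D K, of "\<lambda>x. - f0 x" x y] by auto
  have on_K: "lo k = f0 k" "hi k = f0 k" if "k \<in> K" for k
    unfolding lo_def hi_def using lip_extension_eq[OF D K that, of f0]
      lip_extension_eq[OF D K that, of "\<lambda>x. - f0 x"] LipD(2)[OF f0L] LipD(2)[OF Lip_uminus[OF f0L]]
    by auto
  have lo_hi: "lo x \<le> 1" "-1 \<le> hi x" for x
  proof -
    obtain k where "lo x = f0 k - D x k"
      unfolding lo_def using lip_extension_attained[OF D K] by blast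
    then show "lo x \<le> 1" using LipD(1)[OF f0L, of k] uc_pseudometricD(1)[OF D, of x k] by linarith
    obtain k where "lip_extension D K (\<lambda>x. - f0 x) x = - f0 k - D x k"
      using lip_extension_attained[OF D K] by blast
    then have "hi x = f0 k + D x k" by (simp add: hi_def)
    then show "-1 \<le> hi x" using LipD(1)[OF f0L, of k] uc_pseudometricD(1)[OF D, of x k] by linarith
  qed
  have far: "lo x \<le> -1" "1 \<le> hi x" if x: "\<And>k. k \<in> K \<Longrightarrow> r \<le> \<Delta> x k" for x
  proof -
    have D2: "2 \<le> D x k" if "k \<in> K" for k
      using x[OF that] r(1) by (simp add: D_def field_simps)
    obtain k where k: "k \<in> K" "lo x = f0 k - D x k"
      unfolding lo_def using lip_extension_attained[OF D K] by blast
    then show "lo x \<le> -1" using D2[OF k(1)] LipD(1)[OF f0L, of k] by linarith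
    obtain k where k: "k \<in> K" "lip_extension D K (\<lambda>x. - f0 x) x = - f0 k - D x k"
      using lip_extension_attained[OF D K] by blast
    then have "hi x = f0 k + D x k" by (simp add: hi_def)
    then show "1 \<le> hi x" using D2[OF k(1)] LipD(1)[OF f0L, of k] by linarith
  qed
  have clamp_A: "clamp f \<in> A N" if f: "f \<in> Lip D" for f
  proof -
    have "clamp f \<in> Lip D"
    proof (rule LipI)
      show "\<bar>clamp f x\<bar> \<le> 1" for x
        using lo_hi[of x] LipD(1)[OF f, of x] by (auto simp: clamp_def abs_le_iff max_def min_def)
      show "\<bar>clamp f x - clamp f y\<bar> \<le> D x y" for x y
        unfolding clamp_def by (rule clamp_lipschitz[OF lo_lip LipD(2)[OF f] hi_lip])
    qed
    moreover have "clamp f \<in> U"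
      by (rule K0(3)) (simp add: clamp_def on_K K_def K0(2))
    ultimately show ?thesis using UA by blast
  qed
  obtain T where T: "finite T" "T \<subseteq> Lip \<Delta>" "\<And>f. f \<in> Lip \<Delta> \<Longrightarrow> \<exists>g\<in>T. \<forall>x\<in>K. \<bar>f x - g x\<bar> < r"
    using Lip_finite_net[OF K(1) r(1)] by metis
  have "eventually (\<lambda>n. \<bar>pair (\<kappa> n) g\<bar> < e / 4) sequentially" if "g \<in> T" for g
    using tendstoD[OF null[OF Lip_ucb[OF \<Delta>, of g]], of "e / 4"] that T(2) e by auto
  then have "eventually (\<lambda>n. \<forall>g\<in>T. \<bar>pair (\<kappa> n) g\<bar> < e / 4) sequentially"
    using T(1) by (simp add: eventually_ball_finite)
  with eventually_ge_at_top[of N] show ?thesis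
  proof eventually_elim
    case (elim n)
    show ?case
    proof
      fix f assume f: "f \<in> Lip \<Delta>"
      obtain g where g: "g \<in> T" "\<And>x. x \<in> K \<Longrightarrow> \<bar>f x - g x\<bar> < r" using T(3)[OF f] by blast
      have gL: "g \<in> Lip \<Delta>" using g(1) T(2) by blast
      have cA: "clamp f \<in> A N" "clamp g \<in> A N"
        using clamp_A Lip_mono[OF f \<Delta>D] Lip_mono[OF gL \<Delta>D] by blast+
      have u: "f \<in> ucb_funs" "g \<in> ucb_funs" "clamp f \<in> ucb_funs" "clamp g \<in> ucb_funs"
        using Lip_ucb[OF \<Delta> f] Lip_ucb[OF \<Delta> gL] cA Lip_ucb[OF D] by (auto simp: A_def)
      let ?h = "\<lambda>x. (f x - g x) - (clamp f x - clamp g x)"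
      have h: "\<bar>?h x\<bar> \<le> 6 * r" for x
      proof (cases "\<exists>k\<in>K. \<Delta> x k < r")
        case True
        then obtain k where k: "k \<in> K" "\<Delta> x k < r" by blast
        have "\<bar>f x - g x\<bar> \<le> 3 * r"
          using g(2)[OF k(1)] LipD(2)[OF f, of x k] LipD(2)[OF gL, of x k] k(2) by linarith
        moreover have "\<bar>clamp f x - clamp g x\<bar> \<le> \<bar>f x - g x\<bar>"
          unfolding clamp_def by (rule clamp_lipschitz) auto
        ultimately show ?thesis by linarith
      next
        case False
        then have "lo x \<le> -1" "1 \<le> hi x" using far[of x] by (auto simp: not_less)
        then have "clamp f x = f x" "clamp g x = g x"
          using LipD(1)[OF f, of x] LipD(1)[OF gL, of x]
          by (auto simp: clamp_def max_def min_def abs_le_iff)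
        then show ?thesis using r(1) by simp
      qed
      have "\<bar>pair (\<kappa> n) ?h\<bar> \<le> norm (\<kappa> n) * (6 * r)"
        by (intro abs_blinfun_ucb_le ucb_fun_diff u h)
      also have "\<dots> \<le> C * (6 * r)" using C[of n] r(1) by (intro mult_right_mono) auto
      also note rC
      finally have "\<bar>pair (\<kappa> n) ?h\<bar> \<le> e / 4" .
      moreover have "pair (\<kappa> n) ?h =
          (pair (\<kappa> n) f - pair (\<kappa> n) g) - (pair (\<kappa> n) (clamp f) - pair (\<kappa> n) (clamp g))"
        using u by (simp add: pair_diff ucb_fun_diff)
      moreover have "\<bar>pair (\<kappa> n) (clamp f)\<bar> \<le> e / 8" "\<bar>pair (\<kappa> n) (clamp g)\<bar> \<le> e / 8"
        using cA elim(1) by (auto simp: A_def)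
      moreover have "\<bar>pair (\<kappa> n) g\<bar> < e / 4" using elim(2) g(1) by blast
      ultimately show "\<bar>pair (\<kappa> n) f\<bar> \<le> e" by linarith
    qed
  qed
qed

section \<open>Neighbourhoods in the UEB and weak* topologies\<close>

lemma ueb_seminorm_bdd_above:
  assumes "uc_pseudometric \<Delta>"
  shows "bdd_above ((\<lambda>f. \<bar>pair \<mu> f\<bar>) ` Lip \<Delta>)"
proof (rule bdd_aboveI2)
  show "\<bar>pair \<mu> f\<bar> \<le> norm \<mu> * 1" if "f \<in> Lip \<Delta>" for f
    by (rule abs_blinfun_ucb_le[OF Lip_ucb[OF assms that] LipD(1)[OF that]])
qed

lemma abs_pair_le_ueb_seminorm:
  "uc_pseudometric \<Delta> \<Longrightarrow> f \<in> Lip \<Delta> \<Longrightarrow> \<bar>pair \<mu> f\<bar> \<le> ueb_seminorm \<Delta> \<mu>"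
  unfolding ueb_seminorm_def by (intro cSUP_upper ueb_seminorm_bdd_above)

lemma ueb_seminorm_le:
  assumes "uc_pseudometric \<Delta>" "\<And>f. f \<in> Lip \<Delta> \<Longrightarrow> \<bar>pair \<mu> f\<bar> \<le> e"
  shows "ueb_seminorm \<Delta> \<mu> \<le> e"
  unfolding ueb_seminorm_def using assms Lip_zero by (intro cSUP_least) blast+

lemma ueb_seminorm_triangle:
  assumes "uc_pseudometric \<Delta>"
  shows "ueb_seminorm \<Delta> (\<mu> + \<nu>) \<le> ueb_seminorm \<Delta> \<mu> + ueb_seminorm \<Delta> \<nu>"
proof (rule ueb_seminorm_le[OF assms])
  show "\<bar>pair (\<mu> + \<nu>) f\<bar> \<le> ueb_seminorm \<Delta> \<mu> + ueb_seminorm \<Delta> \<nu>" if "f \<in> Lip \<Delta>" for f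
    using abs_pair_le_ueb_seminorm[OF assms that, of \<mu>] abs_pair_le_ueb_seminorm[OF assms that, of \<nu>]
    by (simp add: blinfun.add_left)
qed

lemma ueb_seminorm_mono:
  assumes "uc_pseudometric \<Delta>" "uc_pseudometric \<Delta>'" "\<And>x y. \<Delta> x y \<le> \<Delta>' x y"
  shows "ueb_seminorm \<Delta> \<mu> \<le> ueb_seminorm \<Delta>' \<mu>"
  by (rule ueb_seminorm_le[OF assms(1)])
    (use abs_pair_le_ueb_seminorm[OF assms(2)] Lip_mono assms(3) in blast)

lemma ueb_seminorm_zero: "uc_pseudometric \<Delta> \<Longrightarrow> ueb_seminorm \<Delta> 0 = 0"
  using ueb_seminorm_le[of \<Delta> 0 0] abs_pair_le_ueb_seminorm[OF _ Lip_zero, of \<Delta> 0]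
  by fastforce

lemma openin_ueb_ball:
  assumes "uc_pseudometric \<Delta>" "0 < e"
  shows "openin ueb {\<nu>. ueb_seminorm \<Delta> (\<nu> - \<mu>) < e}"
  unfolding ueb_def using assms by (intro topology_generated_by_Basis) blast

lemma topspace_ueb: "topspace ueb = UNIV"
proof -
  have uc: "uc_pseudometric (\<lambda>x y :: 'a. 0)"
    by (rule uc_pseudometricI) (auto simp: case_prod_unfold)
  have "\<mu> \<in> topspace ueb" for \<mu> :: "'a dual"
    using openin_subset[OF openin_ueb_ball[OF uc zero_less_one, of \<mu>]]
    by (auto simp: ueb_seminorm_zero[OF uc])
  then show ?thesis by blast
qed

text \<open>The subbasic sets defining the topology are balls of arbitrary centre. Balls about the given point
suffice by the triangle inequality, and a single one suffices because the seminorms are directed: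
\<open>\<Delta> + \<Delta>'\<close> dominates \<open>\<Delta>\<close> and \<open>\<Delta>'\<close>.\<close>

lemma ueb_neighbourhood:
  assumes "openin ueb V" "p \<in> V"
  obtains \<Delta> e where "uc_pseudometric \<Delta>" "0 < e" "\<And>q. ueb_seminorm \<Delta> (q - p) < e \<Longrightarrow> q \<in> V"
proof -
  let ?S = "{{\<nu>. ueb_seminorm \<Delta> (\<nu> - \<mu>) < e} | \<Delta> \<mu> e. uc_pseudometric \<Delta> \<and> 0 < e}"
  have "generate_topology_on ?S V"
    using assms(1) by (simp add: ueb_def openin_topology_generated_by_iff)
  then have "p \<in> V \<Longrightarrow> \<exists>\<Delta> e. uc_pseudometric \<Delta> \<and> 0 < e \<and> (\<forall>q. ueb_seminorm \<Delta> (q - p) < e \<longrightarrow> q \<in> V)"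
  proof induction
    case (Int a b)
    then obtain \<Delta> e \<Delta>' e' where a: "uc_pseudometric \<Delta>" "0 < e" "\<And>q. ueb_seminorm \<Delta> (q - p) < e \<Longrightarrow> q \<in> a"
      and b: "uc_pseudometric \<Delta>'" "0 < e'" "\<And>q. ueb_seminorm \<Delta>' (q - p) < e' \<Longrightarrow> q \<in> b" by blast
    let ?D = "\<lambda>x y. \<Delta> x y + \<Delta>' x y"
    have D: "uc_pseudometric ?D" using a(1) b(1) by (rule uc_pseudometric_add)
    have "ueb_seminorm \<Delta> \<mu> \<le> ueb_seminorm ?D \<mu>" "ueb_seminorm \<Delta>' \<mu> \<le> ueb_seminorm ?D \<mu>" for \<mu>
      using a(1) b(1) D by (auto intro!: ueb_seminorm_mono simp: uc_pseudometricD)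
    then have "q \<in> a \<inter> b" if "ueb_seminorm ?D (q - p) < min e e'" for q
      using a(3)[of q] b(3)[of q] that by (auto intro: le_less_trans)
    moreover have "0 < min e e'" using a(2) b(2) by simp
    ultimately show ?case using D by blast
  next
    case (UN K)
    then obtain k where k: "k \<in> K" "p \<in> k" by blast
    from UN.IH[OF this] show ?case using k(1) by blast
  next
    case (Basis s)
    then obtain \<Delta> \<mu> e where s: "s = {\<nu>. ueb_seminorm \<Delta> (\<nu> - \<mu>) < e}" "uc_pseudometric \<Delta>" by blast
    have "q \<in> s" if "ueb_seminorm \<Delta> (q - p) < e - ueb_seminorm \<Delta> (p - \<mu>)" for q
      using ueb_seminorm_triangle[OF s(2), of "q - p" "p - \<mu>"] that by (simp add: s(1))
    moreover have "0 < e - ueb_seminorm \<Delta> (p - \<mu>)" using Basis.prems by (simp add: s(1))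
    ultimately show ?case using s(2) by blast
  qed simp
  then show ?thesis using assms(2) that by blast
qed

lemma topspace_weak_star: "topspace weak_star = UNIV"
  by (simp add: weak_star_def topspace_pullback_topology)

lemma continuous_map_weak_star_apply: "continuous_map weak_star euclideanreal (\<lambda>\<mu>. blinfun_apply \<mu> f)"
proof -
  have "continuous_map weak_star euclideanreal ((\<lambda>F. F f) \<circ> blinfun_apply)"
    unfolding weak_star_def
    by (intro continuous_map_pullback) (simp add: continuous_map_iff_continuous2)
  then show ?thesis by (simp add: o_def)
qed

lemma openin_weak_star_ball:
  "openin weak_star {\<mu>. \<bar>blinfun_apply \<mu> f - c\<bar> < e}"
proof -
  have "openin weak_star {\<mu> \<in> topspace weak_star. blinfun_apply \<mu> f \<in> ball c e}"
    by (rule openin_continuous_map_preimage[OF continuous_map_weak_star_apply]) simp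
  then show ?thesis
    by (simp add: topspace_weak_star dist_real_def abs_minus_commute)
qed

lemma weak_star_neighbourhood:
  assumes "openin weak_star V" "p \<in> V"
  obtains F d where "finite F" "0 < d"
    "\<And>q. (\<And>f. f \<in> F \<Longrightarrow> \<bar>blinfun_apply q f - blinfun_apply p f\<bar> < d) \<Longrightarrow> q \<in> V"
proof -
  obtain U where U: "open U" "V = blinfun_apply -` U"
    using assms(1) by (auto simp: weak_star_def openin_pullback_topology)
  then obtain F d where "finite F" "0 < d"
    "\<And>q. (\<And>f. f \<in> F \<Longrightarrow> \<bar>q f - blinfun_apply p f\<bar> < d) \<Longrightarrow> q \<in> U"
    using open_fun_finite_coordinates[OF U(1), of "blinfun_apply p"] assms(2) by blast
  then show ?thesis using U(2) that by blast
qed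

lemma limitin_weak_star:
  "limitin weak_star \<sigma> l net \<longleftrightarrow> (\<forall>f. ((\<lambda>n. blinfun_apply (\<sigma> n) f) \<longlongrightarrow> blinfun_apply l f) net)"
proof
  assume "limitin weak_star \<sigma> l net"
  then show "\<forall>f. ((\<lambda>n. blinfun_apply (\<sigma> n) f) \<longlongrightarrow> blinfun_apply l f) net"
    using continuous_map_limit[OF continuous_map_weak_star_apply] by (fastforce simp: o_def)
next
  assume lim: "\<forall>f. ((\<lambda>n. blinfun_apply (\<sigma> n) f) \<longlongrightarrow> blinfun_apply l f) net"
  show "limitin weak_star \<sigma> l net"
    unfolding limitin_def
  proof (intro conjI allI impI)
    fix V assume "openin weak_star V \<and> l \<in> V"
    then obtain F d where F: "finite F" "0 < d"
      "\<And>q. (\<And>f. f \<in> F \<Longrightarrow> \<bar>blinfun_apply q f - blinfun_apply l f\<bar> < d) \<Longrightarrow> q \<in> V"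
      using weak_star_neighbourhood by metis
    have "\<forall>\<^sub>F n in net. \<forall>f\<in>F. \<bar>blinfun_apply (\<sigma> n) f - blinfun_apply l f\<bar> < d"
      using lim F(1,2) by (intro eventually_ball_finite) (auto simp: tendsto_iff dist_real_def)
    then show "\<forall>\<^sub>F n in net. \<sigma> n \<in> V"
      by eventually_elim (use F(3) in blast)
  qed (simp add: topspace_weak_star)
qed

lemma topcontinuous_at_weak_starI:
  assumes "p \<in> topspace X" "\<And>q. q \<in> topspace X \<Longrightarrow> g q \<in> S"
    and "\<And>f e. 0 < e \<Longrightarrow> \<exists>U. openin X U \<and> p \<in> U \<and>
      (\<forall>q\<in>U. \<bar>blinfun_apply (g q) f - blinfun_apply (g p) f\<bar> < e)"
  shows "topcontinuous_at X (subtopology weak_star S) g p"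
  unfolding topcontinuous_at_def
proof (intro conjI ballI allI impI)
  fix V assume V: "openin (subtopology weak_star S) V \<and> g p \<in> V"
  then obtain W where W: "openin weak_star W" "V = W \<inter> S" by (auto simp: openin_subtopology)
  with V obtain F d where F: "finite F" "0 < d"
    "\<And>q. (\<And>f. f \<in> F \<Longrightarrow> \<bar>blinfun_apply q f - blinfun_apply (g p) f\<bar> < d) \<Longrightarrow> q \<in> W"
    using weak_star_neighbourhood[OF W(1)] by blast
  obtain U where U: "\<And>f. openin X (U f)" "\<And>f. p \<in> U f"
    "\<And>f q. q \<in> U f \<Longrightarrow> \<bar>blinfun_apply (g q) f - blinfun_apply (g p) f\<bar> < d"
    using assms(3)[OF F(2)] by metis
  let ?U = "(\<Inter>f\<in>F. U f) \<inter> topspace X"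
  have "openin X ?U" using F(1) U(1) by (intro openin_INT) auto
  moreover have "p \<in> ?U" using U(2) assms(1) by blast
  moreover have "g q \<in> V" if q: "q \<in> ?U" for q
  proof -
    have "g q \<in> W"
    proof (rule F(3))
      fix f assume "f \<in> F"
      then show "\<bar>blinfun_apply (g q) f - blinfun_apply (g p) f\<bar> < d"
        using q U(3) by blast
    qed
    then show ?thesis using q assms(2) W(2) by blast
  qed
  ultimately show "\<exists>U. openin X U \<and> p \<in> U \<and> (\<forall>y\<in>U. g y \<in> V)" by blast
qed (use assms in \<open>auto simp: topspace_weak_star\<close>)

section \<open>Positive functionals\<close>

lemma Mpos_pair_mono:
  assumes "\<mu> \<in> Mpos" "f \<in> ucb_funs" "g \<in> ucb_funs" "\<And>x. f x \<le> g x"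
  shows "pair \<mu> f \<le> pair \<mu> g"
proof -
  have "0 \<le> pair \<mu> (\<lambda>x. g x - f x)"
    using assms by (auto simp: Mpos_def Ucb_inverse ucb_fun_diff)
  then show ?thesis by (simp add: pair_diff assms)
qed

lemma Mpos_abs_pair_le:
  assumes "\<mu> \<in> Mpos" "f \<in> ucb_funs" "g \<in> ucb_funs" "\<And>x. \<bar>f x\<bar> \<le> g x"
  shows "\<bar>pair \<mu> f\<bar> \<le> pair \<mu> g"
proof -
  have "pair \<mu> f \<le> pair \<mu> g"
    using assms(4) by (intro Mpos_pair_mono assms) (auto simp: abs_le_iff)
  moreover have "pair \<mu> (\<lambda>x. -1 * f x) \<le> pair \<mu> g"
    using assms(4) by (intro Mpos_pair_mono assms ucb_fun_scale) (auto simp: abs_le_iff)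
  ultimately show ?thesis using pair_scale[OF assms(2), of \<mu> "-1"] by simp
qed

lemma Mpos_norm_le:
  assumes "\<mu> \<in> Mpos"
  shows "norm \<mu> \<le> pair \<mu> (\<lambda>_. 1)"
proof (rule norm_blinfun_bound)
  have "0 \<le> pair \<mu> (\<lambda>_. 1)"
    using assms by (auto simp: Mpos_def Ucb_inverse ucb_fun_const)
  then show "0 \<le> pair \<mu> (\<lambda>_. 1)" .
  fix f
  have "\<bar>pair \<mu> (apply_ucb f)\<bar> \<le> pair \<mu> (\<lambda>_. norm f * 1)"
    by (rule Mpos_abs_pair_le[OF assms]) (auto intro: apply_ucb ucb_fun_const abs_apply_ucb_le_norm)
  then show "norm (blinfun_apply \<mu> f) \<le> pair \<mu> (\<lambda>_. 1) * norm f"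
    using pair_scale[OF ucb_fun_const, of \<mu> "norm f" 1] by (simp add: apply_ucb_inverse mult.commute)
qed

text \<open>Let \<open>g\<close> be the distance to a finite set \<open>K\<close>, truncated at \<open>1\<close>. It is in \<open>Lip \<Delta>\<close> and vanishes on \<open>K\<close>,
so \<open>\<mu>\<^sub>0 g < t\<close> for a suitable \<open>K\<close>, since \<open>\<mu>\<^sub>0 \<in> Mu\<close>; then \<open>\<mu> g < 2 t\<close> for \<open>\<mu>\<close> near \<open>\<mu>\<^sub>0\<close>. If
\<open>f, h \<in> Lip \<Delta>\<close> differ by less than \<open>t\<close> on \<open>K\<close>, then \<open>\<bar>f - h\<bar> \<le> t + 2 g\<close> everywhere, so positivity
bounds \<open>\<mu> f - \<mu> h\<close> by the values of \<open>\<mu>\<close> on the two fixed functions \<open>1\<close> and \<open>g\<close>. Finitely many \<open>h\<close>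
cover \<open>Lip \<Delta>\<close> in this sense, and these are controlled by the weak* topology.\<close>

lemma Mupos_weak_star_uniform_on_Lip:
  fixes \<mu>0 :: "'a::uniform_space dual"
  assumes "\<mu>0 \<in> Mupos" "uc_pseudometric \<Delta>" "0 < e"
  obtains U where "openin weak_star U" "\<mu>0 \<in> U"
    "\<And>\<mu> f. \<mu> \<in> U \<Longrightarrow> \<mu> \<in> Mpos \<Longrightarrow> f \<in> Lip \<Delta> \<Longrightarrow> \<bar>pair (\<mu> - \<mu>0) f\<bar> \<le> e"
proof -
  have \<mu>0: "\<mu>0 \<in> Mu" "\<mu>0 \<in> Mpos" using assms(1) by (auto simp: Mupos_def)
  note one = ucb_fun_const[of 1]
  define M where "M = pair \<mu>0 (\<lambda>_. 1)"
  have M: "0 \<le> M" using Mpos_norm_le[OF \<mu>0(2)] norm_ge_zero order_trans unfolding M_def by blast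
  (* The errors below add up to at most t (2 M + 8). *)
  define t where "t = e / (2 * M + 8)"
  have t: "0 < t" using M assms(3) by (simp add: t_def add_nonneg_pos)
  have te: "t * (2 * M + 8) = e" using M by (simp add: t_def)
  obtain K0 d where K0: "finite K0" "0 < d"
    "\<And>F. F \<in> Lip \<Delta> \<Longrightarrow> (\<And>x. x \<in> K0 \<Longrightarrow> \<bar>F x\<bar> < d) \<Longrightarrow> \<bar>pair \<mu>0 F\<bar> < t"
    using Mu_small_on_finite[OF \<mu>0(1) assms(2) t] by blast
  (* An arbitrary point is added because extensions are maxima over a nonempty set. *)
  define K where "K = insert undefined K0"
  have K: "finite K" "K \<noteq> {}" using K0 by (auto simp: K_def)
  define g where "g x = min 1 (- lip_extension \<Delta> K (\<lambda>_. 0) x)" for x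
  have ext: "\<exists>k\<in>K. - lip_extension \<Delta> K (\<lambda>_. 0) x = \<Delta> x k" for x
    using lip_extension_attained[OF assms(2) K, of "\<lambda>_. 0" x] by auto
  have g0: "0 \<le> g x" for x
  proof -
    obtain k where "- lip_extension \<Delta> K (\<lambda>_. 0) x = \<Delta> x k" using ext by blast
    then have "0 \<le> - lip_extension \<Delta> K (\<lambda>_. 0) x"
      using uc_pseudometricD(1)[OF assms(2), of x k] by linarith
    then show ?thesis by (simp add: g_def)
  qed
  have gL: "g \<in> Lip \<Delta>"
  proof (rule LipI)
    show "\<bar>g x\<bar> \<le> 1" for x using g0[of x] by (simp add: g_def)
    show "\<bar>g x - g y\<bar> \<le> \<Delta> x y" for x y
      using lip_extension_lipschitz[OF assms(2) K, of "\<lambda>_. 0" x y]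
      by (auto simp: g_def min_def)
  qed
  have "g x = 0" if "x \<in> K" for x
    using lip_extension_eq[OF assms(2) K that, of "\<lambda>_. 0"] uc_pseudometricD(1)[OF assms(2)]
    by (simp add: g_def)
  then have \<mu>0g: "\<bar>pair \<mu>0 g\<bar> < t" using K0(2) by (intro K0(3)[OF gL]) (simp add: K_def)
  obtain T where T: "finite T" "T \<subseteq> Lip \<Delta>" "\<And>f. f \<in> Lip \<Delta> \<Longrightarrow> \<exists>h\<in>T. \<forall>x\<in>K. \<bar>f x - h x\<bar> < t"
    using Lip_finite_net[OF K(1) t] by metis
  define W where "W f s = {\<mu>. \<bar>pair \<mu> f - pair \<mu>0 f\<bar> < s}" for f s
  define U where "U = W (\<lambda>_. 1) 1 \<inter> W g t \<inter> ((\<Inter>f\<in>T. W f t) \<inter> topspace weak_star)"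
  show ?thesis
  proof (rule that)
    show "openin weak_star U"
      unfolding U_def W_def using T(1) by (intro openin_Int openin_INT openin_weak_star_ball)
    show "\<mu>0 \<in> U" using t by (simp add: U_def W_def topspace_weak_star)
    fix \<mu> f assume \<mu>: "\<mu> \<in> U" "\<mu> \<in> Mpos" and f: "f \<in> Lip \<Delta>"
    obtain h where h: "h \<in> T" "\<And>x. x \<in> K \<Longrightarrow> \<bar>f x - h x\<bar> < t" using T(3)[OF f] by blast
    have hL: "h \<in> Lip \<Delta>" using h(1) T(2) by blast
    have u: "f \<in> ucb_funs" "h \<in> ucb_funs" "g \<in> ucb_funs"
      using f hL gL Lip_ucb[OF assms(2)] by auto
    have near: "\<bar>f x - h x\<bar> \<le> t * 1 + 2 * g x" for x
    proof -
      obtain k where k: "k \<in> K" "- lip_extension \<Delta> K (\<lambda>_. 0) x = \<Delta> x k" using ext by blast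
      have "\<bar>f x - h x\<bar> \<le> t + 2 * \<Delta> x k"
        using h(2)[OF k(1)] LipD(2)[OF f, of x k] LipD(2)[OF hL, of x k] by linarith
      moreover have "\<bar>f x - h x\<bar> \<le> t + 2 * 1"
        using LipD(1)[OF f, of x] LipD(1)[OF hL, of x] t by linarith
      ultimately show ?thesis using k(2) by (simp add: g_def min_def)
    qed
    have diff: "\<bar>pair \<nu> f - pair \<nu> h\<bar> \<le> t * pair \<nu> (\<lambda>_. 1) + 2 * pair \<nu> g" if "\<nu> \<in> Mpos" for \<nu>
    proof -
      have "\<bar>pair \<nu> (\<lambda>x. f x - h x)\<bar> \<le> pair \<nu> (\<lambda>x. t * 1 + 2 * g x)"
        using near by (intro Mpos_abs_pair_le that ucb_fun_diff ucb_fun_add ucb_fun_scale one u)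
      also have "\<dots> = pair \<nu> (\<lambda>x. t * 1) + pair \<nu> (\<lambda>x. 2 * g x)"
        by (rule pair_add) (intro ucb_fun_scale one u)+
      also have "\<dots> = t * pair \<nu> (\<lambda>_. 1) + 2 * pair \<nu> g"
        by (simp only: pair_scale one u)
      finally show ?thesis by (simp add: pair_diff u)
    qed
    have "\<bar>pair \<mu> (\<lambda>_. 1) - M\<bar> < 1" "\<bar>pair \<mu> g - pair \<mu>0 g\<bar> < t" "\<bar>pair \<mu> h - pair \<mu>0 h\<bar> < t"
      using \<mu>(1) h(1) by (auto simp: U_def W_def M_def)
    moreover from this(1) have "t * pair \<mu> (\<lambda>_. 1) \<le> t * (M + 1)"
      using t by (intro mult_left_mono) auto
    moreover have "t * pair \<mu>0 (\<lambda>_. 1) = t * M" by (simp add: M_def)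
    ultimately have "\<bar>pair \<mu> f - pair \<mu>0 f\<bar> \<le> t * (M + 1) + 2 * (2 * t) + t * M + 2 * t + t"
      using diff[OF \<mu>(2)] diff[OF \<mu>0(2)] \<mu>0g by linarith
    also have "\<dots> \<le> t * (2 * M + 8)" using t by (simp add: algebra_simps)
    finally show "\<bar>pair (\<mu> - \<mu>0) f\<bar> \<le> e" by (simp add: te blinfun.diff_left)
  qed
qed

section \<open>Convolution\<close>

text \<open>The supremum of \<open>\<Delta>\<close> itself may be infinite. Truncation at \<open>2\<close> is harmless for \<open>Lip \<Delta>\<close>, whose
members have values in an interval of length \<open>2\<close>.\<close>

definition action_pseudometric ::
  "('x \<Rightarrow> 'y \<Rightarrow> 'y) \<Rightarrow> ('y \<Rightarrow> 'y \<Rightarrow> real) \<Rightarrow> 'x \<Rightarrow> 'x \<Rightarrow> real" where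
  "action_pseudometric m \<Delta> x x' = (SUP y. min 2 (\<Delta> (m x y) (m x' y)))"

definition fibre_integral ::
  "('x \<Rightarrow> 'y::uniform_space \<Rightarrow> 'y) \<Rightarrow> 'y dual \<Rightarrow> ('y \<Rightarrow> real) \<Rightarrow> 'x \<Rightarrow> real" where
  "fibre_integral m \<nu> f x = pair \<nu> (\<lambda>y. f (m x y))"

context
  fixes m :: "'x::{uniform_space, semigroup_mult} \<Rightarrow> 'y::uniform_space \<Rightarrow> 'y"
  assumes act: "semiuniform_action m"
begin

lemma action_ucb: "f \<in> ucb_funs \<Longrightarrow> (\<lambda>y. f (m x y)) \<in> ucb_funs"
  using semiuniform_action_inner[OF act, of "Ucb f" x] by (simp add: Ucb_inverse)

lemma fibre_integral_ucb: "f \<in> ucb_funs \<Longrightarrow> fibre_integral m \<nu> f \<in> ucb_funs"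
  using semiuniform_action_outer[OF act, of \<nu> "Ucb f"]
  by (simp add: Ucb_inverse fibre_integral_def[abs_def])

lemma pair_conv: "f \<in> ucb_funs \<Longrightarrow> pair (conv m \<mu> \<nu>) f = pair \<mu> (fibre_integral m \<nu> f)"
  by (simp add: blinfun_apply_conv[OF act] Ucb_inverse fibre_integral_def[abs_def])

lemma abs_fibre_integral_le:
  "f \<in> ucb_funs \<Longrightarrow> (\<And>y. \<bar>f y\<bar> \<le> b) \<Longrightarrow> \<bar>fibre_integral m \<nu> f x\<bar> \<le> norm \<nu> * b"
  unfolding fibre_integral_def by (intro abs_blinfun_ucb_le action_ucb) auto

lemma fibre_integral_diff:
  "fibre_integral m (\<nu> - \<nu>') f x = fibre_integral m \<nu> f x - fibre_integral m \<nu>' f x"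
  by (simp add: fibre_integral_def blinfun.diff_left)

lemma norm_conv_le: "norm (conv m \<mu> \<nu>) \<le> norm \<mu> * norm \<nu>"
proof (rule norm_blinfun_bound)
  fix f
  have "\<bar>pair \<mu> (fibre_integral m \<nu> (apply_ucb f))\<bar> \<le> norm \<mu> * (norm \<nu> * norm f)"
    by (intro abs_blinfun_ucb_le abs_fibre_integral_le fibre_integral_ucb apply_ucb
        abs_apply_ucb_le_norm)
  then show "norm (blinfun_apply (conv m \<mu> \<nu>) f) \<le> norm \<mu> * norm \<nu> * norm f"
    using pair_conv[OF apply_ucb, of \<mu> \<nu> f] by (simp add: apply_ucb_inverse mult.assoc)
qed simp

lemma conv_Mpos:
  assumes "\<mu> \<in> Mpos" "\<nu> \<in> Mpos"
  shows "conv m \<mu> \<nu> \<in> Mpos"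
  unfolding Mpos_def
proof (intro CollectI allI impI)
  fix f :: "'y ucb" assume f: "\<forall>y. 0 \<le> apply_ucb f y"
  have "0 \<le> fibre_integral m \<nu> (apply_ucb f) x" for x
    using assms(2) f by (auto simp: fibre_integral_def Mpos_def Ucb_inverse action_ucb apply_ucb)
  then have "0 \<le> pair \<mu> (fibre_integral m \<nu> (apply_ucb f))"
    using assms(1) by (auto simp: Mpos_def Ucb_inverse fibre_integral_ucb apply_ucb)
  then show "0 \<le> blinfun_apply (conv m \<mu> \<nu>) f"
    using pair_conv[OF apply_ucb, of \<mu> \<nu> f] by (simp add: apply_ucb_inverse)
qed

lemma uc_pseudometric_section:
  assumes "uc_pseudometric \<Delta>"
  shows "uc_pseudometric (\<lambda>y y'. \<Delta> (m x y) (m x y'))"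
proof (rule uc_pseudometric_pullback[OF assms])
  show "uniformly_continuous_on UNIV (m x)"
    using act unfolding semiuniform_action_def by blast
qed

lemma Lip_section: "f \<in> Lip \<Delta> \<Longrightarrow> (\<lambda>y. f (m x y)) \<in> Lip (\<lambda>y y'. \<Delta> (m x y) (m x y'))"
  by (rule LipI) (rule LipD, assumption)+

context
  fixes \<Delta> :: "'y \<Rightarrow> 'y \<Rightarrow> real"
  assumes \<Delta>: "uc_pseudometric \<Delta>"
begin

lemma action_pseudometric_ge: "min 2 (\<Delta> (m x y) (m x' y)) \<le> action_pseudometric m \<Delta> x x'"
  unfolding action_pseudometric_def by (intro cSUP_upper bdd_aboveI2[where M = 2]) auto

lemma action_pseudometric_le:
  "(\<And>y. min 2 (\<Delta> (m x y) (m x' y)) \<le> b) \<Longrightarrow> action_pseudometric m \<Delta> x x' \<le> b"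
  unfolding action_pseudometric_def by (intro cSUP_least) auto

lemma uc_action_pseudometric: "uc_pseudometric (action_pseudometric m \<Delta>)"
proof (rule uc_pseudometricI)
  show "0 \<le> action_pseudometric m \<Delta> x x'" for x x'
    using action_pseudometric_ge[of x undefined x'] uc_pseudometricD(1)[OF \<Delta>]
    by (meson min.boundedI order_trans zero_le_numeral)
  show "action_pseudometric m \<Delta> x x = 0" for x
    by (simp add: action_pseudometric_def uc_pseudometricD(2)[OF \<Delta>])
  show "action_pseudometric m \<Delta> x x' = action_pseudometric m \<Delta> x' x" for x x'
    unfolding action_pseudometric_def by (subst uc_pseudometricD(3)[OF \<Delta>]) (rule refl)
  show "action_pseudometric m \<Delta> x z \<le> action_pseudometric m \<Delta> x y + action_pseudometric m \<Delta> y z"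
    for x y z
  proof (rule action_pseudometric_le)
    fix w
    have "min 2 (\<Delta> (m x w) (m z w)) \<le> min 2 (\<Delta> (m x w) (m y w)) + min 2 (\<Delta> (m y w) (m z w))"
      using uc_pseudometricD(4)[OF \<Delta>, of "m x w" "m z w" "m y w"]
        uc_pseudometricD(1)[OF \<Delta>, of "m x w" "m y w"] uc_pseudometricD(1)[OF \<Delta>, of "m y w" "m z w"]
      by (auto simp: min_def)
    then show "min 2 (\<Delta> (m x w) (m z w)) \<le> action_pseudometric m \<Delta> x y + action_pseudometric m \<Delta> y z"
      using action_pseudometric_ge[of x w y] action_pseudometric_ge[of y w z] by linarith
  qed
  fix e :: real assume e: "0 < e"
  have "eventually (\<lambda>(y, y'). \<Delta> y y' < e / 2) uniformity"
    using e by (intro uc_pseudometric_eventually_small[OF \<Delta>]) simp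
  then have "eventually (\<lambda>(x, x'). \<forall>y. \<Delta> (m x y) (m x' y) < e / 2) uniformity"
    using conjunct1[OF conjunct2[OF act[unfolded semiuniform_action_def]], rule_format,
      of "\<lambda>(y, y'). \<Delta> y y' < e / 2"] by simp
  then show "eventually (\<lambda>(x, x'). action_pseudometric m \<Delta> x x' < e) uniformity"
  proof eventually_elim
    case (elim p)
    obtain x x' where p: "p = (x, x')" by force
    have "\<Delta> (m x y) (m x' y) < e / 2" for y
      using elim unfolding p prod.case by blast
    then have "action_pseudometric m \<Delta> x x' \<le> e / 2"
      by (intro action_pseudometric_le min.coboundedI2 less_imp_le)
    then show ?case using e by (simp add: p)
  qed
qed

lemma Lip_action_diff:
  assumes "f \<in> Lip \<Delta>"
  shows "\<bar>f (m x y) - f (m x' y)\<bar> \<le> action_pseudometric m \<Delta> x x'"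
proof -
  have "\<bar>f (m x y) - f (m x' y)\<bar> \<le> min 2 (\<Delta> (m x y) (m x' y))"
    using LipD[OF assms, of "m x y"] LipD(1)[OF assms, of "m x' y"] by fastforce
  then show ?thesis using action_pseudometric_ge by (rule order_trans)
qed

lemma Lip_orbit: "f \<in> Lip \<Delta> \<Longrightarrow> (\<lambda>x. f (m x y)) \<in> Lip (action_pseudometric m \<Delta>)"
  by (rule LipI) (rule LipD(1) Lip_action_diff, assumption)+

text \<open>The estimate behind all continuity statements: for \<open>f\<close> in \<open>Lip \<Delta>\<close> and \<open>\<nu>\<close> in a norm bounded set, all
these functions lie in a fixed multiple of a single set of Lipschitz functions on the semigroup.\<close>

lemma fibre_integral_Lip:
  assumes f: "f \<in> Lip \<Delta>" and c: "norm \<nu> \<le> c" "0 < c"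
  shows "(\<lambda>x. fibre_integral m \<nu> f x / c) \<in> Lip (action_pseudometric m \<Delta>)"
proof (rule Lip_normalize[OF c(2)])
  note u = Lip_ucb[OF \<Delta> f]
  show "\<bar>fibre_integral m \<nu> f x\<bar> \<le> c" for x
    using abs_fibre_integral_le[OF u LipD(1)[OF f], of \<nu> x] c(1) by simp
  fix x x'
  have "\<bar>pair \<nu> (\<lambda>y. f (m x y) - f (m x' y))\<bar> \<le> norm \<nu> * action_pseudometric m \<Delta> x x'"
    by (intro abs_blinfun_ucb_le ucb_fun_diff action_ucb u Lip_action_diff f)
  also have "\<dots> \<le> c * action_pseudometric m \<Delta> x x'"
    using c(1) uc_pseudometricD(1)[OF uc_action_pseudometric] by (rule mult_right_mono)
  finally show "\<bar>fibre_integral m \<nu> f x - fibre_integral m \<nu> f x'\<bar> \<le> c * action_pseudometric m \<Delta> x x'"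
    by (simp add: fibre_integral_def pair_diff action_ucb u)
qed

lemma fibre_integral_pair_normalize:
  assumes "f \<in> Lip \<Delta>" "norm \<nu> \<le> c" "0 < c"
  shows "pair \<mu> (fibre_integral m \<nu> f) = c * pair \<mu> (\<lambda>x. fibre_integral m \<nu> f x / c)"
  using pair_normalize(1)[OF Lip_ucb[OF uc_action_pseudometric fibre_integral_Lip[OF assms]] assms(3)] .

text \<open>The set \<open>K\<close> and the tolerances depend on \<open>\<mu>\<^sub>0\<close>, but neither on \<open>\<nu>\<close> and \<open>\<nu>\<^sub>0\<close> nor on \<open>f\<close>; the
uniformity in \<open>f\<close> is what the UEB topology requires. Since \<open>\<nu> - \<nu>\<^sub>0\<close> has norm at most \<open>2 b\<close>, its
fibre integral is in \<open>2 b\<close> times \<open>Lip\<close> of the action pseudometric, where \<open>\<mu>\<^sub>0\<close> is controlled by the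
values on \<open>K\<close>.\<close>

lemma conv_close:
  assumes \<mu>0: "\<mu>0 \<in> Mu" and b: "0 < b" and e: "0 < e"
  obtains K \<eta> \<delta> where "finite K" "0 < \<eta>" "0 < \<delta>"
    "\<And>\<mu> \<nu> \<nu>0 f. norm \<nu> \<le> b \<Longrightarrow> norm \<nu>0 \<le> b \<Longrightarrow> f \<in> Lip \<Delta> \<Longrightarrow>
      (\<And>g. g \<in> Lip (action_pseudometric m \<Delta>) \<Longrightarrow> \<bar>pair (\<mu> - \<mu>0) g\<bar> \<le> \<eta>) \<Longrightarrow>
      (\<And>x. x \<in> K \<Longrightarrow> \<bar>pair (\<nu> - \<nu>0) (\<lambda>y. f (m x y))\<bar> < \<delta>) \<Longrightarrow>
      \<bar>pair (conv m \<mu> \<nu> - conv m \<mu>0 \<nu>0) f\<bar> \<le> e"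
proof -
  have "0 < e / (4 * b)" using b e by simp
  then obtain K d where K: "finite K" "0 < d" "\<And>F. F \<in> Lip (action_pseudometric m \<Delta>) \<Longrightarrow>
      (\<And>x. x \<in> K \<Longrightarrow> \<bar>F x\<bar> < d) \<Longrightarrow> \<bar>pair \<mu>0 F\<bar> < e / (4 * b)"
    using Mu_small_on_finite[OF \<mu>0 uc_action_pseudometric] by blast
  show ?thesis
  proof (rule that[OF K(1), of "e / (2 * b)" "2 * b * d"])
    show "0 < e / (2 * b)" "0 < 2 * b * d" using b e K(2) by simp_all
    fix \<mu> \<nu> \<nu>0 f
    assume \<nu>: "norm \<nu> \<le> b" "norm \<nu>0 \<le> b" and f: "f \<in> Lip \<Delta>"
      and \<mu>: "\<And>g. g \<in> Lip (action_pseudometric m \<Delta>) \<Longrightarrow> \<bar>pair (\<mu> - \<mu>0) g\<bar> \<le> e / (2 * b)"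
      and small: "\<And>x. x \<in> K \<Longrightarrow> \<bar>pair (\<nu> - \<nu>0) (\<lambda>y. f (m x y))\<bar> < 2 * b * d"
    note u = Lip_ucb[OF \<Delta> f]
    have b2: "norm (\<nu> - \<nu>0) \<le> 2 * b" "0 < 2 * b"
      using norm_triangle_ineq4[of \<nu> \<nu>0] \<nu> b by linarith+
    have "\<bar>pair (\<mu> - \<mu>0) (fibre_integral m \<nu> f)\<bar> \<le> b * (e / (2 * b))"
      unfolding fibre_integral_pair_normalize[OF f \<nu>(1) b] abs_mult abs_of_pos[OF b]
      by (rule mult_left_mono[OF \<mu>[OF fibre_integral_Lip[OF f \<nu>(1) b]] less_imp_le[OF b]])
    then have 1: "\<bar>pair (\<mu> - \<mu>0) (fibre_integral m \<nu> f)\<bar> \<le> e / 2" using b by simp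
    have "\<bar>pair \<mu>0 (\<lambda>x. fibre_integral m (\<nu> - \<nu>0) f x / (2 * b))\<bar> < e / (4 * b)"
    proof (rule K(3)[OF fibre_integral_Lip[OF f b2]])
      show "\<bar>fibre_integral m (\<nu> - \<nu>0) f x / (2 * b)\<bar> < d" if "x \<in> K" for x
        using small[OF that] b by (simp add: fibre_integral_def pos_divide_less_eq mult.commute)
    qed
    then have "\<bar>pair \<mu>0 (fibre_integral m (\<nu> - \<nu>0) f)\<bar> \<le> 2 * b * (e / (4 * b))"
      unfolding fibre_integral_pair_normalize[OF f b2] abs_mult[of "2 * b"] abs_of_pos[OF b2(2)]
      by (rule mult_left_mono[OF less_imp_le less_imp_le[OF b2(2)]])
    then have 2: "\<bar>pair \<mu>0 (fibre_integral m (\<nu> - \<nu>0) f)\<bar> \<le> e / 2" using b by simp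
    have "fibre_integral m (\<nu> - \<nu>0) f = (\<lambda>x. fibre_integral m \<nu> f x - fibre_integral m \<nu>0 f x)"
      by (rule ext) (rule fibre_integral_diff)
    then have "pair \<mu>0 (fibre_integral m (\<nu> - \<nu>0) f) =
        pair \<mu>0 (fibre_integral m \<nu> f) - pair \<mu>0 (fibre_integral m \<nu>0 f)"
      by (simp add: pair_diff fibre_integral_ucb u)
    then have "pair (conv m \<mu> \<nu> - conv m \<mu>0 \<nu>0) f =
        pair (\<mu> - \<mu>0) (fibre_integral m \<nu> f) + pair \<mu>0 (fibre_integral m (\<nu> - \<nu>0) f)"
      by (simp add: blinfun.diff_left pair_conv u)
    with 1 2 show "\<bar>pair (conv m \<mu> \<nu> - conv m \<mu>0 \<nu>0) f\<bar> \<le> e" by linarith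
  qed
qed

end

text \<open>If \<open>g\<close> tends to \<open>f\<close> pointwise within \<open>Lip \<Delta>\<close>, the fibre integrals converge pointwise because \<open>\<nu> \<in> Mu\<close>,
and then \<open>\<mu> \<in> Mu\<close> can be applied, as they stay in a multiple of one set of Lipschitz functions.\<close>

lemma conv_Mu:
  assumes "\<mu> \<in> Mu" "\<nu> \<in> Mu"
  shows "conv m \<mu> \<nu> \<in> Mu"
  unfolding Mu_def
proof (intro CollectI allI impI)
  fix \<Delta> :: "'y \<Rightarrow> 'y \<Rightarrow> real" assume \<Delta>: "uc_pseudometric \<Delta>"
  define c where "c = norm \<nu> + 1"
  have c: "norm \<nu> \<le> c" "0 < c" by (simp_all add: c_def add_nonneg_pos)
  show "continuous_on (Lip \<Delta>) (\<lambda>f. pair (conv m \<mu> \<nu>) f)"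
    unfolding continuous_on_def
  proof
    fix f assume f: "f \<in> Lip \<Delta>"
    have ev: "\<forall>\<^sub>F g in at f within Lip \<Delta>. g \<in> Lip \<Delta>"
      by (simp add: eventually_at_filter)
    have point: "((\<lambda>g. g y) \<longlongrightarrow> f y) (at f within Lip \<Delta>)" for y
      by (rule tendsto_coordinate) (rule tendsto_ident_at)
    have "((\<lambda>g. fibre_integral m \<nu> g x) \<longlongrightarrow> fibre_integral m \<nu> f x) (at f within Lip \<Delta>)" for x
      unfolding fibre_integral_def
    proof (rule Mu_tendsto[OF assms(2) uc_pseudometric_section[OF \<Delta>, of x] zero_less_one point])
      show "(\<lambda>y. f (m x y) / 1) \<in> Lip (\<lambda>y y'. \<Delta> (m x y) (m x y'))"
        using Lip_section[OF f] by simp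
      show "\<forall>\<^sub>F g in at f within Lip \<Delta>. (\<lambda>y. g (m x y) / 1) \<in> Lip (\<lambda>y y'. \<Delta> (m x y) (m x y'))"
        using ev by eventually_elim (simp add: Lip_section)
    qed
    then have "((\<lambda>g. pair \<mu> (fibre_integral m \<nu> g)) \<longlongrightarrow> pair \<mu> (fibre_integral m \<nu> f)) (at f within Lip \<Delta>)"
    proof (rule Mu_tendsto[OF assms(1) uc_action_pseudometric[OF \<Delta>] c(2)])
      show "(\<lambda>x. fibre_integral m \<nu> f x / c) \<in> Lip (action_pseudometric m \<Delta>)"
        by (rule fibre_integral_Lip[OF \<Delta> f c])
      show "\<forall>\<^sub>F g in at f within Lip \<Delta>. (\<lambda>x. fibre_integral m \<nu> g x / c) \<in> Lip (action_pseudometric m \<Delta>)"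
        using ev by eventually_elim (rule fibre_integral_Lip[OF \<Delta> _ c])
    qed
    moreover have "\<forall>\<^sub>F g in at f within Lip \<Delta>. pair \<mu> (fibre_integral m \<nu> g) = pair (conv m \<mu> \<nu>) g"
      using ev by eventually_elim (simp add: pair_conv Lip_ucb[OF \<Delta>])
    ultimately show "((\<lambda>g. pair (conv m \<mu> \<nu>) g) \<longlongrightarrow> pair (conv m \<mu> \<nu>) f) (at f within Lip \<Delta>)"
      using tendsto_cong by (force simp: pair_conv Lip_ucb[OF \<Delta> f])
  qed
qed

lemma conv_ueb_continuous_at:
  assumes "bounded B" "\<mu>0 \<in> Mu" "\<nu>0 \<in> B"
  shows "topcontinuous_at (prod_topology ueb (subtopology ueb B)) ueb
    (\<lambda>(\<mu>, \<nu>). conv m \<mu> \<nu>) (\<mu>0, \<nu>0)"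
  unfolding topcontinuous_at_def
proof (intro conjI ballI allI impI)
  fix V assume V: "openin ueb V \<and> (case (\<mu>0, \<nu>0) of (\<mu>, \<nu>) \<Rightarrow> conv m \<mu> \<nu>) \<in> V"
  then obtain \<Delta> e where \<Delta>: "uc_pseudometric \<Delta>" and e: "0 < e"
    and near: "\<And>q. ueb_seminorm \<Delta> (q - conv m \<mu>0 \<nu>0) < e \<Longrightarrow> q \<in> V"
    using ueb_neighbourhood[of V "conv m \<mu>0 \<nu>0"] by auto
  obtain b where b: "0 < b" "\<And>\<nu>. \<nu> \<in> B \<Longrightarrow> norm \<nu> \<le> b"
    using assms(1) bounded_pos by blast
  obtain K \<eta> \<delta> where K: "finite K" "0 < \<eta>" "0 < \<delta>"
    and close: "\<And>\<mu> \<nu> \<nu>0 f. norm \<nu> \<le> b \<Longrightarrow> norm \<nu>0 \<le> b \<Longrightarrow> f \<in> Lip \<Delta> \<Longrightarrow>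
      (\<And>g. g \<in> Lip (action_pseudometric m \<Delta>) \<Longrightarrow> \<bar>pair (\<mu> - \<mu>0) g\<bar> \<le> \<eta>) \<Longrightarrow>
      (\<And>x. x \<in> K \<Longrightarrow> \<bar>pair (\<nu> - \<nu>0) (\<lambda>y. f (m x y))\<bar> < \<delta>) \<Longrightarrow>
      \<bar>pair (conv m \<mu> \<nu> - conv m \<mu>0 \<nu>0) f\<bar> \<le> e / 2"
    using conv_close[OF \<Delta> assms(2) b(1), of "e / 2"] e by (metis half_gt_zero)
  define S where "S x = (\<lambda>y y'. \<Delta> (m x y) (m x y'))" for x
  have S: "uc_pseudometric (S x)" for x unfolding S_def by (rule uc_pseudometric_section[OF \<Delta>])
  define U1 where "U1 = {\<mu>. ueb_seminorm (action_pseudometric m \<Delta>) (\<mu> - \<mu>0) < \<eta>}"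
  define U2 where "U2 = (\<Inter>x\<in>K. {\<nu>. ueb_seminorm (S x) (\<nu> - \<nu>0) < \<delta>}) \<inter> topspace ueb"
  have "openin ueb U1" unfolding U1_def by (intro openin_ueb_ball uc_action_pseudometric \<Delta> K)
  moreover have "openin ueb U2"
    unfolding U2_def using K(1) by (intro openin_INT openin_ueb_ball S K)
  ultimately have "openin (prod_topology ueb (subtopology ueb B)) (U1 \<times> (U2 \<inter> B))"
    by (auto simp: openin_prod_Times_iff openin_subtopology)
  moreover have "(\<mu>0, \<nu>0) \<in> U1 \<times> (U2 \<inter> B)"
    using K assms(3) by (simp add: U1_def U2_def topspace_ueb ueb_seminorm_zero S
        uc_action_pseudometric[OF \<Delta>])
  moreover have "conv m \<mu> \<nu> \<in> V" if \<mu>: "\<mu> \<in> U1" and \<nu>: "\<nu> \<in> U2 \<inter> B" for \<mu> \<nu>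
  proof (rule near)
    have "ueb_seminorm \<Delta> (conv m \<mu> \<nu> - conv m \<mu>0 \<nu>0) \<le> e / 2"
    proof (rule ueb_seminorm_le[OF \<Delta>], rule close)
      show "norm \<nu> \<le> b" "norm \<nu>0 \<le> b" using b(2) \<nu> assms(3) by auto
      show "\<bar>pair (\<mu> - \<mu>0) g\<bar> \<le> \<eta>" if "g \<in> Lip (action_pseudometric m \<Delta>)" for g
        using abs_pair_le_ueb_seminorm[OF uc_action_pseudometric[OF \<Delta>] that, of "\<mu> - \<mu>0"] \<mu>
        by (simp add: U1_def)
      show "\<bar>pair (\<nu> - \<nu>0) (\<lambda>y. f (m x y))\<bar> < \<delta>" if "f \<in> Lip \<Delta>" "x \<in> K" for f x
        using abs_pair_le_ueb_seminorm[OF S Lip_section[OF that(1), of x, folded S_def], of "\<nu> - \<nu>0"]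
          \<nu> that(2) by (force simp: U2_def)
    qed
    then show "ueb_seminorm \<Delta> (conv m \<mu> \<nu> - conv m \<mu>0 \<nu>0) < e" using e by simp
  qed
  ultimately show "\<exists>U. openin (prod_topology ueb (subtopology ueb B)) U \<and> (\<mu>0, \<nu>0) \<in> U \<and>
      (\<forall>y\<in>U. (case y of (\<mu>, \<nu>) \<Rightarrow> conv m \<mu> \<nu>) \<in> V)"
    by (intro exI[of _ "U1 \<times> (U2 \<inter> B)"]) auto
qed (use assms in \<open>auto simp: topspace_ueb\<close>)

lemma conv_weak_star_sequentially_continuous:
  "sequentially_continuous_map
    (prod_topology (subtopology weak_star Mu) (subtopology weak_star Mu))
    (subtopology weak_star Mu) (\<lambda>(\<mu>, \<nu>). conv m \<mu> \<nu>)"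
  unfolding sequentially_continuous_map_def
proof (intro conjI allI impI)
  show "(\<lambda>(\<mu>, \<nu>). conv m \<mu> \<nu>) \<in> topspace (prod_topology (subtopology weak_star Mu) (subtopology weak_star Mu))
      \<rightarrow> topspace (subtopology weak_star Mu)"
    by (auto simp: topspace_weak_star conv_Mu)
  fix \<sigma> :: "nat \<Rightarrow> 'x dual \<times> 'y dual" and l
  assume \<sigma>: "range \<sigma> \<subseteq> topspace (prod_topology (subtopology weak_star Mu) (subtopology weak_star Mu)) \<and>
    limitin (prod_topology (subtopology weak_star Mu) (subtopology weak_star Mu)) \<sigma> l sequentially"
  define \<mu> \<nu> where "\<mu> = fst \<circ> \<sigma>" and "\<nu> = snd \<circ> \<sigma>"
  obtain \<mu>0 \<nu>0 where l: "l = (\<mu>0, \<nu>0)" by force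
  have Mu: "\<mu> n \<in> Mu" "\<nu> n \<in> Mu" for n
    using \<sigma> by (auto simp: \<mu>_def \<nu>_def image_subset_iff mem_Times_iff)
  have Mu0: "\<mu>0 \<in> Mu" "\<nu>0 \<in> Mu"
    and lim: "limitin weak_star \<mu> \<mu>0 sequentially" "limitin weak_star \<nu> \<nu>0 sequentially"
    using \<sigma> by (auto simp: limitin_pairwise limitin_subtopology l \<mu>_def \<nu>_def)
  have \<mu>lim: "(\<lambda>n. blinfun_apply (\<mu> n) f) \<longlonglongrightarrow> blinfun_apply \<mu>0 f" for f
    using lim(1) by (simp add: limitin_weak_star)
  have \<nu>lim: "(\<lambda>n. blinfun_apply (\<nu> n) f) \<longlonglongrightarrow> blinfun_apply \<nu>0 f" for f
    using lim(2) by (simp add: limitin_weak_star)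
  obtain C where C: "\<And>n. norm (\<mu> n - \<mu>0) \<le> C"
  proof -
    have "(\<lambda>n. blinfun_apply (\<mu> n - \<mu>0) f) \<longlonglongrightarrow> 0" for f
      using tendsto_diff[OF \<mu>lim tendsto_const, of f "blinfun_apply \<mu>0 f"] by (simp add: blinfun.diff_left)
    then show ?thesis using uniform_boundedness[of "\<lambda>n. \<mu> n - \<mu>0"] that convergent_imp_bounded by blast
  qed
  obtain b0 where b0: "\<And>n. norm (\<nu> n) \<le> b0"
    using uniform_boundedness[of \<nu>] \<nu>lim convergent_imp_bounded by blast
  define b where "b = \<bar>b0\<bar> + norm \<nu>0 + 1"
  have b: "0 < b" "norm (\<nu> n) \<le> b" "norm \<nu>0 \<le> b" for n
    using b0[of n] norm_ge_zero[of \<nu>0] abs_ge_self[of b0] abs_ge_zero[of b0]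
    unfolding b_def by linarith+
  have conv: "(\<lambda>n. pair (conv m (\<mu> n) (\<nu> n)) f) \<longlonglongrightarrow> pair (conv m \<mu>0 \<nu>0) f"
    if f: "f \<in> Lip \<Delta>" and \<Delta>: "uc_pseudometric \<Delta>" for f \<Delta>
  proof (rule tendstoI)
    fix e :: real assume e: "0 < e"
    obtain K \<eta> \<delta> where K: "finite K" "0 < \<eta>" "0 < \<delta>"
      and close: "\<And>\<mu> \<nu> \<nu>0 f. norm \<nu> \<le> b \<Longrightarrow> norm \<nu>0 \<le> b \<Longrightarrow> f \<in> Lip \<Delta> \<Longrightarrow>
        (\<And>g. g \<in> Lip (action_pseudometric m \<Delta>) \<Longrightarrow> \<bar>pair (\<mu> - \<mu>0) g\<bar> \<le> \<eta>) \<Longrightarrow>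
        (\<And>x. x \<in> K \<Longrightarrow> \<bar>pair (\<nu> - \<nu>0) (\<lambda>y. f (m x y))\<bar> < \<delta>) \<Longrightarrow>
        \<bar>pair (conv m \<mu> \<nu> - conv m \<mu>0 \<nu>0) f\<bar> \<le> e / 2"
      using conv_close[OF \<Delta> Mu0(1) b(1), of "e / 2"] e by (metis half_gt_zero)
    have "(\<lambda>n. pair (\<mu> n - \<mu>0) g) \<longlonglongrightarrow> 0" for g
      using tendsto_diff[OF \<mu>lim tendsto_const, of "Ucb g" "pair \<mu>0 g"] by (simp add: blinfun.diff_left)
    then have "\<forall>\<^sub>F n in sequentially. \<forall>g\<in>Lip (action_pseudometric m \<Delta>). \<bar>pair (\<mu> n - \<mu>0) g\<bar> \<le> \<eta>"
      by (intro Mu_weak_star_null_sequence_uniform_on_Lip[OF _ C _ uc_action_pseudometric[OF \<Delta>] K(2)]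
          Mu_diff Mu Mu0)
    moreover have "\<forall>\<^sub>F n in sequentially. \<forall>x\<in>K. \<bar>pair (\<nu> n - \<nu>0) (\<lambda>y. f (m x y))\<bar> < \<delta>"
      using tendstoD[OF \<nu>lim K(3)] K(1)
      by (intro eventually_ball_finite) (simp_all add: dist_real_def blinfun.diff_left)
    ultimately show "\<forall>\<^sub>F n in sequentially. dist (pair (conv m (\<mu> n) (\<nu> n)) f) (pair (conv m \<mu>0 \<nu>0) f) < e"
    proof eventually_elim
      case (elim n)
      then have "\<bar>pair (conv m (\<mu> n) (\<nu> n) - conv m \<mu>0 \<nu>0) f\<bar> \<le> e / 2"
        by (intro close b f) auto
      then show ?case using e by (simp add: dist_real_def blinfun.diff_left)
    qed
  qed
  have "(\<lambda>n. blinfun_apply (conv m (\<mu> n) (\<nu> n)) f) \<longlonglongrightarrow> blinfun_apply (conv m \<mu>0 \<nu>0) f" for f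
  proof -
    obtain \<Delta> c where \<Delta>: "uc_pseudometric \<Delta>" and c: "0 < c" and h: "(\<lambda>y. apply_ucb f y / c) \<in> Lip \<Delta>"
      using ucb_funs_Lip[OF apply_ucb] by blast
    have "blinfun_apply \<kappa> f = c * pair \<kappa> (\<lambda>y. apply_ucb f y / c)" for \<kappa> :: "'y dual"
      using pair_normalize(1)[OF Lip_ucb[OF \<Delta> h] c] by (simp add: apply_ucb_inverse)
    then show ?thesis using tendsto_mult_left[OF conv[OF h \<Delta>], of c] by simp
  qed
  then have "limitin (subtopology weak_star Mu) (\<lambda>n. conv m (\<mu> n) (\<nu> n)) (conv m \<mu>0 \<nu>0) sequentially"
    by (simp add: limitin_subtopology limitin_weak_star conv_Mu Mu Mu0)
  then show "limitin (subtopology weak_star Mu) (\<lambda>n. case \<sigma> n of (\<mu>, \<nu>) \<Rightarrow> conv m \<mu> \<nu>)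
      (case l of (\<mu>, \<nu>) \<Rightarrow> conv m \<mu> \<nu>) sequentially"
    by (simp add: l \<mu>_def \<nu>_def case_prod_unfold)
qed

lemma conv_weak_star_continuous_at_Mupos:
  assumes "\<mu>0 \<in> Mupos" "\<nu>0 \<in> Mpos"
  shows "topcontinuous_at
    (prod_topology (subtopology weak_star Mpos) (subtopology weak_star Mpos))
    (subtopology weak_star Mpos) (\<lambda>(\<mu>, \<nu>). conv m \<mu> \<nu>) (\<mu>0, \<nu>0)"
proof (rule topcontinuous_at_weak_starI)
  have \<mu>0: "\<mu>0 \<in> Mu" "\<mu>0 \<in> Mpos" using assms(1) by (auto simp: Mupos_def)
  show "(\<mu>0, \<nu>0) \<in> topspace (prod_topology (subtopology weak_star Mpos) (subtopology weak_star Mpos))"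
    using \<mu>0 assms(2) by (simp add: topspace_weak_star)
  show "(case q of (\<mu>, \<nu>) \<Rightarrow> conv m \<mu> \<nu>) \<in> Mpos"
    if "q \<in> topspace (prod_topology (subtopology weak_star Mpos) (subtopology weak_star Mpos))" for q
    using that by (auto simp: conv_Mpos)
  fix f :: "'y ucb" and e :: real assume e: "0 < e"
  obtain \<Delta> c where \<Delta>: "uc_pseudometric \<Delta>" and c: "0 < c" and h: "(\<lambda>y. apply_ucb f y / c) \<in> Lip \<Delta>"
    using ucb_funs_Lip[OF apply_ucb] by blast
  define h' where "h' = (\<lambda>y. apply_ucb f y / c)"
  have f_eq: "blinfun_apply \<kappa> f = c * pair \<kappa> h'" for \<kappa> :: "'y dual"
    using pair_normalize(1)[OF Lip_ucb[OF \<Delta> h] c] by (simp add: apply_ucb_inverse h'_def)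
  (* The norm of a positive functional is its value at 1, so it is bounded near \<nu>0 by this b. *)
  define b where "b = pair \<nu>0 (\<lambda>_. 1) + 1"
  have "0 \<le> pair \<nu>0 (\<lambda>_. 1)" using Mpos_norm_le[OF assms(2)] norm_ge_zero order_trans by blast
  then have b: "0 < b" by (simp add: b_def)
  have ec: "0 < e / (2 * c)" using e c by simp
  obtain K \<eta> \<delta> where K: "finite K" "0 < \<eta>" "0 < \<delta>"
    and close: "\<And>\<mu> \<nu> \<nu>0 f. norm \<nu> \<le> b \<Longrightarrow> norm \<nu>0 \<le> b \<Longrightarrow> f \<in> Lip \<Delta> \<Longrightarrow>
      (\<And>g. g \<in> Lip (action_pseudometric m \<Delta>) \<Longrightarrow> \<bar>pair (\<mu> - \<mu>0) g\<bar> \<le> \<eta>) \<Longrightarrow>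
      (\<And>x. x \<in> K \<Longrightarrow> \<bar>pair (\<nu> - \<nu>0) (\<lambda>y. f (m x y))\<bar> < \<delta>) \<Longrightarrow>
      \<bar>pair (conv m \<mu> \<nu> - conv m \<mu>0 \<nu>0) f\<bar> \<le> e / (2 * c)"
    using conv_close[OF \<Delta> \<mu>0(1) b ec] by metis
  obtain U1 where U1: "openin weak_star U1" "\<mu>0 \<in> U1"
    "\<And>\<mu> g. \<mu> \<in> U1 \<Longrightarrow> \<mu> \<in> Mpos \<Longrightarrow> g \<in> Lip (action_pseudometric m \<Delta>) \<Longrightarrow> \<bar>pair (\<mu> - \<mu>0) g\<bar> \<le> \<eta>"
    using Mupos_weak_star_uniform_on_Lip[OF assms(1) uc_action_pseudometric[OF \<Delta>] K(2)] by blast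
  define W where "W g s = {\<nu>. \<bar>pair \<nu> g - pair \<nu>0 g\<bar> < s}" for g s
  define U2 where "U2 = W (\<lambda>_. 1) 1 \<inter> ((\<Inter>x\<in>K. W (\<lambda>y. h' (m x y)) \<delta>) \<inter> topspace weak_star)"
  have "openin weak_star U2"
    unfolding U2_def W_def using K(1) by (intro openin_Int openin_INT openin_weak_star_ball)
  with U1(1) have "openin (prod_topology (subtopology weak_star Mpos) (subtopology weak_star Mpos))
      ((U1 \<inter> Mpos) \<times> (U2 \<inter> Mpos))"
    by (auto simp: openin_prod_Times_iff openin_subtopology)
  moreover have "(\<mu>0, \<nu>0) \<in> (U1 \<inter> Mpos) \<times> (U2 \<inter> Mpos)"
    using U1(2) \<mu>0 assms(2) K by (simp add: U2_def W_def topspace_weak_star)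
  moreover have "\<bar>blinfun_apply (conv m \<mu> \<nu>) f - blinfun_apply (conv m \<mu>0 \<nu>0) f\<bar> < e"
    if \<mu>: "\<mu> \<in> U1 \<inter> Mpos" and \<nu>: "\<nu> \<in> U2 \<inter> Mpos" for \<mu> \<nu>
  proof -
    have "\<bar>pair (conv m \<mu> \<nu> - conv m \<mu>0 \<nu>0) h'\<bar> \<le> e / (2 * c)"
    proof (rule close)
      show "norm \<nu> \<le> b" "norm \<nu>0 \<le> b"
        using Mpos_norm_le[of \<nu>] Mpos_norm_le[OF assms(2)] \<nu> by (auto simp: U2_def W_def b_def)
      show "h' \<in> Lip \<Delta>" using h by (simp add: h'_def)
      show "\<bar>pair (\<mu> - \<mu>0) g\<bar> \<le> \<eta>" if "g \<in> Lip (action_pseudometric m \<Delta>)" for g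
        using U1(3) \<mu> that by blast
      show "\<bar>pair (\<nu> - \<nu>0) (\<lambda>y. h' (m x y))\<bar> < \<delta>" if "x \<in> K" for x
        using \<nu> that by (auto simp: U2_def W_def blinfun.diff_left)
    qed
    then have "c * \<bar>pair (conv m \<mu> \<nu> - conv m \<mu>0 \<nu>0) h'\<bar> \<le> e / 2"
      using c by (simp add: field_simps)
    moreover have "\<bar>blinfun_apply (conv m \<mu> \<nu>) f - blinfun_apply (conv m \<mu>0 \<nu>0) f\<bar> =
        c * \<bar>pair (conv m \<mu> \<nu> - conv m \<mu>0 \<nu>0) h'\<bar>"
      using c by (simp add: f_eq blinfun.diff_left right_diff_distrib[symmetric] abs_mult)
    ultimately show ?thesis using e by linarith
  qed
  ultimately show "\<exists>U. openin (prod_topology (subtopology weak_star Mpos) (subtopology weak_star Mpos)) U \<and>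
      (\<mu>0, \<nu>0) \<in> U \<and> (\<forall>q\<in>U. \<bar>blinfun_apply (case q of (\<mu>, \<nu>) \<Rightarrow> conv m \<mu> \<nu>) f -
        blinfun_apply (case (\<mu>0, \<nu>0) of (\<mu>, \<nu>) \<Rightarrow> conv m \<mu> \<nu>) f\<bar> < e)"
    by (intro exI[of _ "(U1 \<inter> Mpos) \<times> (U2 \<inter> Mpos)"]) auto
qed

text \<open>Exchange of the order of integration. Approximating \<open>\<mu>\<close> uniformly on \<open>Lip\<close> of the action
pseudometric by \<open>\<Sum>x\<in>K. c x * F x\<close> changes \<open>h\<close> by little in the sup norm, since the orbit functions
\<open>x \<mapsto> f (m x y)\<close> are in that set; this shows at once that \<open>h\<close> is uniformly continuous, although the
maps \<open>m x\<close> need not be uniformly equicontinuous in \<open>x\<close>. It changes \<open>\<mu>\<close> of the fibre integral by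
little, too, and for finite sums the exchange is linearity of \<open>\<nu>\<close>.\<close>

lemma conv_Fubini:
  assumes \<mu>: "\<mu> \<in> Mu" and f: "f \<in> Lip \<Delta>" and \<Delta>: "uc_pseudometric \<Delta>"
  defines "h \<equiv> \<lambda>y. pair \<mu> (\<lambda>x. f (m x y))"
  shows "h \<in> ucb_funs" "pair (conv m \<mu> \<nu>) f = pair \<nu> h"
proof -
  note u = Lip_ucb[OF \<Delta> f]
  have approx: "\<exists>K c. finite K \<and> (\<forall>F\<in>Lip (action_pseudometric m \<Delta>). \<bar>pair \<mu> F - (\<Sum>x\<in>K. c x * F x)\<bar> \<le> e)"
    if "0 < e" for e
    using Mu_molecular_approximation[OF \<mu> uc_action_pseudometric[OF \<Delta>] that] by metis
  have mol: "(\<lambda>y. \<Sum>x\<in>K. c x * f (m x y)) \<in> ucb_funs" for K c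
    by (intro ucb_fun_sum ucb_fun_scale action_ucb u)
  show h: "h \<in> ucb_funs"
  proof (rule ucb_fun_uniform_limit)
    fix e :: real assume "0 < e"
    then obtain K c where "\<forall>F\<in>Lip (action_pseudometric m \<Delta>). \<bar>pair \<mu> F - (\<Sum>x\<in>K. c x * F x)\<bar> \<le> e"
      using approx by blast
    then have "\<forall>y. \<bar>(\<Sum>x\<in>K. c x * f (m x y)) - h y\<bar> \<le> e"
      unfolding h_def using Lip_orbit[OF \<Delta> f] by (metis abs_minus_commute)
    then show "\<exists>g\<in>ucb_funs. \<forall>y. \<bar>g y - h y\<bar> \<le> e" by (rule bexI[OF _ mol])
  qed
  have "\<bar>pair (conv m \<mu> \<nu>) f - pair \<nu> h\<bar> \<le> e" if e: "0 < e" for e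
  proof -
    define n where "n = norm \<nu> + 1"
    have n: "norm \<nu> \<le> n" "0 < n" by (simp_all add: n_def add_nonneg_pos)
    define d where "d = e / (2 * n)"
    have d: "0 < d" "n * d = e / 2" using e n by (simp_all add: d_def)
    obtain K c where K: "\<And>F. F \<in> Lip (action_pseudometric m \<Delta>) \<Longrightarrow> \<bar>pair \<mu> F - (\<Sum>x\<in>K. c x * F x)\<bar> \<le> d"
      using approx[OF d(1)] by blast
    let ?s = "\<Sum>x\<in>K. c x * fibre_integral m \<nu> f x"
    have "\<bar>pair \<nu> (\<lambda>y. h y - (\<Sum>x\<in>K. c x * f (m x y)))\<bar> \<le> norm \<nu> * d"
      using K[OF Lip_orbit[OF \<Delta> f]] by (intro abs_blinfun_ucb_le ucb_fun_diff h mol) (simp add: h_def)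
    also have "\<dots> \<le> n * d" using n d(1) by (intro mult_right_mono) auto
    finally have 1: "\<bar>pair \<nu> h - ?s\<bar> \<le> e / 2"
      by (simp add: pair_diff h mol pair_sum pair_scale ucb_fun_scale action_ucb u fibre_integral_def d(2))
    have "(\<Sum>x\<in>K. c x * (fibre_integral m \<nu> f x / n)) = ?s / n"
      by (simp add: sum_divide_distrib)
    then have "\<bar>pair \<mu> (\<lambda>x. fibre_integral m \<nu> f x / n) - ?s / n\<bar> \<le> d"
      using K[OF fibre_integral_Lip[OF \<Delta> f n]] by simp
    then have "n * \<bar>pair \<mu> (\<lambda>x. fibre_integral m \<nu> f x / n) - ?s / n\<bar> \<le> n * d"
      using n by (intro mult_left_mono) auto
    then have "\<bar>n * pair \<mu> (\<lambda>x. fibre_integral m \<nu> f x / n) - ?s\<bar> \<le> n * d"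
      using n(2) abs_mult[of n "pair \<mu> (\<lambda>x. fibre_integral m \<nu> f x / n) - ?s / n"]
      by (simp add: right_diff_distrib)
    then have 2: "\<bar>pair (conv m \<mu> \<nu>) f - ?s\<bar> \<le> e / 2"
      by (simp add: pair_conv u fibre_integral_pair_normalize[OF \<Delta> f n] d(2))
    from 1 2 show ?thesis by linarith
  qed
  then have "\<bar>pair (conv m \<mu> \<nu>) f - pair \<nu> h\<bar> \<le> 0" by (rule field_le_epsilon) simp
  then show "pair (conv m \<mu> \<nu>) f = pair \<nu> h" by simp
qed

lemma conv_weak_star_continuous_right:
  assumes "\<mu> \<in> Mu"
  shows "continuous_map weak_star weak_star (conv m \<mu>)"
proof -
  have "continuous_map weak_star euclideanreal (\<lambda>\<nu>. blinfun_apply (conv m \<mu> \<nu>) f)" for f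
  proof -
    obtain \<Delta> c where \<Delta>: "uc_pseudometric \<Delta>" and c: "0 < c" and h: "(\<lambda>y. apply_ucb f y / c) \<in> Lip \<Delta>"
      using ucb_funs_Lip[OF apply_ucb] by blast
    define g where "g y = pair \<mu> (\<lambda>x. apply_ucb f (m x y) / c)" for y
    have "blinfun_apply (conv m \<mu> \<nu>) f = blinfun_apply \<nu> (c *\<^sub>R Ucb g)" for \<nu>
      using pair_normalize(1)[OF Lip_ucb[OF \<Delta> h] c, of "conv m \<mu> \<nu>"] conv_Fubini(2)[OF assms h \<Delta>, of \<nu>]
      by (simp add: apply_ucb_inverse blinfun.scaleR_right g_def[abs_def])
    then show ?thesis using continuous_map_weak_star_apply by simp
  qed
  then have "continuous_map weak_star (product_topology (\<lambda>_. euclideanreal) UNIV) (blinfun_apply \<circ> conv m \<mu>)"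
    by (simp add: continuous_map_componentwise_UNIV o_def)
  then show ?thesis
    unfolding weak_star_def[where 'a = 'y]
    by (intro continuous_map_pullback') (auto simp: euclidean_product_topology)
qed

end

theorem theorem2p4:
  fixes m :: "'x::{uniform_space, t2_space, semigroup_mult} \<Rightarrow> 'y::{uniform_space, t2_space} \<Rightarrow> 'y"
  assumes "semiuniform_action m"
  shows "(\<forall>(\<mu> :: 'x dual) (\<nu> :: 'y dual). norm (conv m \<mu> \<nu>) \<le> norm \<mu> * norm \<nu>) \<and>
    (\<forall>(B :: 'y dual set) \<mu>\<^sub>0 \<nu>\<^sub>0. bounded B \<and> \<mu>\<^sub>0 \<in> Mu \<and> \<nu>\<^sub>0 \<in> B \<longrightarrow>
      topcontinuous_at (prod_topology ueb (subtopology ueb B)) ueb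
        (\<lambda>(\<mu>, \<nu>). conv m \<mu> \<nu>) (\<mu>\<^sub>0, \<nu>\<^sub>0)) \<and>
    sequentially_continuous_map
      (prod_topology (subtopology weak_star Mu) (subtopology weak_star Mu))
      (subtopology weak_star Mu) (\<lambda>(\<mu>, \<nu>). conv m \<mu> \<nu>) \<and>
    (\<forall>\<mu>\<^sub>0 \<nu>\<^sub>0. \<mu>\<^sub>0 \<in> Mupos \<and> \<nu>\<^sub>0 \<in> Mpos \<longrightarrow>
      topcontinuous_at
        (prod_topology (subtopology weak_star Mpos) (subtopology weak_star Mpos))
        (subtopology weak_star Mpos) (\<lambda>(\<mu>, \<nu>). conv m \<mu> \<nu>) (\<mu>\<^sub>0, \<nu>\<^sub>0)) \<and>
    (\<forall>\<mu>\<in>Mu. continuous_map weak_star weak_star (conv m \<mu>))"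
  using norm_conv_le[OF assms] conv_ueb_continuous_at[OF assms]
    conv_weak_star_sequentially_continuous[OF assms] conv_weak_star_continuous_at_Mupos[OF assms]
    conv_weak_star_continuous_right[OF assms]
  by blast

end
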